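(* Let $\mathcal{E}$ be a topos that satisfies (NS) and (DQO), and for each object $X$ of $\mathcal{E}$ let $\Pi X$ be the decidable quotient of $X$ given by (DQO). For an object $X$ of $\mathcal{E}$, $\Pi X=1$ (that is, $\Pi X$ is terminal) if and only if the collection $\mathrm{Sub}_c(X)$ of complemented subobjects of $X$ has exactly two elements, i.e. if and only if $X$ is connected.
   Context: An object $X$ of a topos $\mathcal{E}$ is decidable if its diagonal $X\rightarrowtail X\times X$ is a complemented subobject. $1$ denotes the terminal object and $2$ denotes $1+1$. An object $X$ is connected if it has exactly two complemented subobjects. (NS): Any object of $\mathcal{E}$ is either initial or has a global element (an arrow from the terminal object $1$). (DQO): There exists a unique decidable quotient for any given object along which any arrow to $2$ factors uniquely. That is, for every object $X$ there is a unique (up to isomorphism under $X$) epimorphism $p_X:X\twoheadrightarrow \Pi X$ with $\Pi X$ decidable such that every arrow $X\to 2$ factors uniquely through $p_X$. *)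

theory Defs
  imports "HOL-Algebra.Order"
begin

section \<open>Categories\<close>

record ('o, 'm) cat =
  Ob :: "'o set"
  Mor :: "'m set"
  Dom :: "'m \<Rightarrow> 'o"
  Cod :: "'m \<Rightarrow> 'o"
  Id :: "'o \<Rightarrow> 'm"
  Comp :: "'m \<Rightarrow> 'm \<Rightarrow> 'm"  (infixl \<open>\<cdot>\<index>\<close> 70)

text \<open>Composition is written in the usual order: \<open>g \<cdot> f\<close> is \<open>f\<close> followed by \<open>g\<close>.\<close>

definition hom_set :: "('o, 'm) cat \<Rightarrow> 'o \<Rightarrow> 'o \<Rightarrow> 'm set" where
  "hom_set C X Y = {f \<in> Mor C. Dom C f = X \<and> Cod C f = Y}"

locale category =
  fixes C :: "('o, 'm) cat" (structure)
  assumes dom_in_Ob: "f \<in> Mor C \<Longrightarrow> Dom C f \<in> Ob C"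
    and cod_in_Ob: "f \<in> Mor C \<Longrightarrow> Cod C f \<in> Ob C"
    and id_in_hom: "X \<in> Ob C \<Longrightarrow> Id C X \<in> hom_set C X X"
    and comp_in_hom: "f \<in> hom_set C X Y \<Longrightarrow> g \<in> hom_set C Y Z \<Longrightarrow> g \<cdot> f \<in> hom_set C X Z"
    and comp_id_right: "f \<in> hom_set C X Y \<Longrightarrow> f \<cdot> Id C X = f"
    and comp_id_left: "f \<in> hom_set C X Y \<Longrightarrow> Id C Y \<cdot> f = f"
    and comp_assoc: "f \<in> hom_set C W X \<Longrightarrow> g \<in> hom_set C X Y \<Longrightarrow> h \<in> hom_set C Y Z \<Longrightarrow>
      h \<cdot> (g \<cdot> f) = (h \<cdot> g) \<cdot> f"

definition monic :: "('o, 'm) cat \<Rightarrow> 'm \<Rightarrow> bool" where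
  "monic C m \<longleftrightarrow> m \<in> Mor C \<and>
     (\<forall>T\<in>Ob C. \<forall>u\<in>hom_set C T (Dom C m). \<forall>v\<in>hom_set C T (Dom C m).
        m \<cdot>\<^bsub>C\<^esub> u = m \<cdot>\<^bsub>C\<^esub> v \<longrightarrow> u = v)"

definition epic :: "('o, 'm) cat \<Rightarrow> 'm \<Rightarrow> bool" where
  "epic C e \<longleftrightarrow> e \<in> Mor C \<and>
     (\<forall>T\<in>Ob C. \<forall>u\<in>hom_set C (Cod C e) T. \<forall>v\<in>hom_set C (Cod C e) T.
        u \<cdot>\<^bsub>C\<^esub> e = v \<cdot>\<^bsub>C\<^esub> e \<longrightarrow> u = v)"

definition iso_arrow :: "('o, 'm) cat \<Rightarrow> 'm \<Rightarrow> bool" where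
  "iso_arrow C f \<longleftrightarrow> f \<in> Mor C \<and>
     (\<exists>g\<in>hom_set C (Cod C f) (Dom C f).
        g \<cdot>\<^bsub>C\<^esub> f = Id C (Dom C f) \<and> f \<cdot>\<^bsub>C\<^esub> g = Id C (Cod C f))"


section \<open>Universal constructions\<close>

text \<open>Universal objects are described by predicates, so that no choice of representatives is made.\<close>

definition terminal :: "('o, 'm) cat \<Rightarrow> 'o \<Rightarrow> bool" where
  "terminal C I \<longleftrightarrow> I \<in> Ob C \<and> (\<forall>X\<in>Ob C. \<exists>!f. f \<in> hom_set C X I)"

definition initial :: "('o, 'm) cat \<Rightarrow> 'o \<Rightarrow> bool" where
  "initial C Z \<longleftrightarrow> Z \<in> Ob C \<and> (\<forall>X\<in>Ob C. \<exists>!f. f \<in> hom_set C Z X)"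

definition is_product :: "('o, 'm) cat \<Rightarrow> 'o \<Rightarrow> 'o \<Rightarrow> 'o \<Rightarrow> 'm \<Rightarrow> 'm \<Rightarrow> bool" where
  "is_product C X Y P p q \<longleftrightarrow> p \<in> hom_set C P X \<and> q \<in> hom_set C P Y \<and>
     (\<forall>T\<in>Ob C. \<forall>f\<in>hom_set C T X. \<forall>g\<in>hom_set C T Y.
        \<exists>!h. h \<in> hom_set C T P \<and> p \<cdot>\<^bsub>C\<^esub> h = f \<and> q \<cdot>\<^bsub>C\<^esub> h = g)"

definition is_coproduct :: "('o, 'm) cat \<Rightarrow> 'o \<Rightarrow> 'o \<Rightarrow> 'o \<Rightarrow> 'm \<Rightarrow> 'm \<Rightarrow> bool" where
  "is_coproduct C X Y S i j \<longleftrightarrow> i \<in> hom_set C X S \<and> j \<in> hom_set C Y S \<and>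
     (\<forall>T\<in>Ob C. \<forall>f\<in>hom_set C X T. \<forall>g\<in>hom_set C Y T.
        \<exists>!h. h \<in> hom_set C S T \<and> h \<cdot>\<^bsub>C\<^esub> i = f \<and> h \<cdot>\<^bsub>C\<^esub> j = g)"

definition is_equalizer :: "('o, 'm) cat \<Rightarrow> 'm \<Rightarrow> 'm \<Rightarrow> 'm \<Rightarrow> bool" where
  "is_equalizer C f g e \<longleftrightarrow> e \<in> hom_set C (Dom C e) (Dom C f) \<and> f \<cdot>\<^bsub>C\<^esub> e = g \<cdot>\<^bsub>C\<^esub> e \<and>
     (\<forall>T\<in>Ob C. \<forall>u\<in>hom_set C T (Dom C f). f \<cdot>\<^bsub>C\<^esub> u = g \<cdot>\<^bsub>C\<^esub> u \<longrightarrow>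
        (\<exists>!h. h \<in> hom_set C T (Dom C e) \<and> e \<cdot>\<^bsub>C\<^esub> h = u))"

definition is_coequalizer :: "('o, 'm) cat \<Rightarrow> 'm \<Rightarrow> 'm \<Rightarrow> 'm \<Rightarrow> bool" where
  "is_coequalizer C f g e \<longleftrightarrow> e \<in> hom_set C (Cod C f) (Cod C e) \<and> e \<cdot>\<^bsub>C\<^esub> f = e \<cdot>\<^bsub>C\<^esub> g \<and>
     (\<forall>T\<in>Ob C. \<forall>u\<in>hom_set C (Cod C f) T. u \<cdot>\<^bsub>C\<^esub> f = u \<cdot>\<^bsub>C\<^esub> g \<longrightarrow>
        (\<exists>!h. h \<in> hom_set C (Cod C e) T \<and> h \<cdot>\<^bsub>C\<^esub> e = u))"

definition is_pullback :: "('o, 'm) cat \<Rightarrow> 'm \<Rightarrow> 'm \<Rightarrow> 'm \<Rightarrow> 'm \<Rightarrow> bool" where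
  "is_pullback C f g p q \<longleftrightarrow>
     p \<in> hom_set C (Dom C p) (Dom C f) \<and> q \<in> hom_set C (Dom C p) (Dom C g) \<and>
     f \<cdot>\<^bsub>C\<^esub> p = g \<cdot>\<^bsub>C\<^esub> q \<and>
     (\<forall>T\<in>Ob C. \<forall>u\<in>hom_set C T (Dom C f). \<forall>v\<in>hom_set C T (Dom C g).
        f \<cdot>\<^bsub>C\<^esub> u = g \<cdot>\<^bsub>C\<^esub> v \<longrightarrow>
        (\<exists>!h. h \<in> hom_set C T (Dom C p) \<and> p \<cdot>\<^bsub>C\<^esub> h = u \<and> q \<cdot>\<^bsub>C\<^esub> h = v))"

text \<open>
  \<open>E\<close> is an exponential \<open>B\<^sup>A\<close> with evaluation \<open>ev : E \<times> A \<rightarrow> B\<close>, the product \<open>E \<times> A\<close> being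
  presented by \<open>(P, p, q)\<close>. In the universal property, \<open>k\<close> is the arrow \<open>g \<times> id\<close>.
\<close>
definition is_exponential ::
    "('o, 'm) cat \<Rightarrow> 'o \<Rightarrow> 'o \<Rightarrow> 'o \<Rightarrow> 'o \<Rightarrow> 'm \<Rightarrow> 'm \<Rightarrow> 'm \<Rightarrow> bool" where
  "is_exponential C A B E P p q ev \<longleftrightarrow> is_product C E A P p q \<and> ev \<in> hom_set C P B \<and>
     (\<forall>Z Q r s f. is_product C Z A Q r s \<longrightarrow> f \<in> hom_set C Q B \<longrightarrow>
        (\<exists>!g. g \<in> hom_set C Z E \<and>
           (\<exists>k\<in>hom_set C Q P. p \<cdot>\<^bsub>C\<^esub> k = g \<cdot>\<^bsub>C\<^esub> r \<and> q \<cdot>\<^bsub>C\<^esub> k = s \<and> ev \<cdot>\<^bsub>C\<^esub> k = f)))"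

definition is_subobject_classifier :: "('o, 'm) cat \<Rightarrow> 'o \<Rightarrow> 'm \<Rightarrow> bool" where
  "is_subobject_classifier C Om t \<longleftrightarrow> t \<in> hom_set C (Dom C t) Om \<and> terminal C (Dom C t) \<and>
     (\<forall>m. monic C m \<longrightarrow>
        (\<exists>!c. c \<in> hom_set C (Cod C m) Om \<and> (\<exists>u. is_pullback C c t m u)))"


section \<open>Toposes\<close>

text \<open>
  The Lawvere--Tierney definition of an elementary topos: finite limits and colimits, exponentials,
  and a subobject classifier. As usual, finite limits are given by a terminal object, binary
  products and equalizers, and finite colimits dually.
\<close>
locale elementary_topos = category +
  assumes ex_terminal: "\<exists>I. terminal C I"
    and ex_product: "X \<in> Ob C \<Longrightarrow> Y \<in> Ob C \<Longrightarrow> \<exists>P p q. is_product C X Y P p q"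
    and ex_equalizer: "f \<in> hom_set C X Y \<Longrightarrow> g \<in> hom_set C X Y \<Longrightarrow> \<exists>e. is_equalizer C f g e"
    and ex_initial: "\<exists>Z. initial C Z"
    and ex_coproduct: "X \<in> Ob C \<Longrightarrow> Y \<in> Ob C \<Longrightarrow> \<exists>S i j. is_coproduct C X Y S i j"
    and ex_coequalizer: "f \<in> hom_set C X Y \<Longrightarrow> g \<in> hom_set C X Y \<Longrightarrow> \<exists>e. is_coequalizer C f g e"
    and ex_exponential: "A \<in> Ob C \<Longrightarrow> B \<in> Ob C \<Longrightarrow> \<exists>E P p q ev. is_exponential C A B E P p q ev"
    and ex_subobject_classifier: "\<exists>Om t. is_subobject_classifier C Om t"


section \<open>Subobjects\<close>

definition monos_into :: "('o, 'm) cat \<Rightarrow> 'o \<Rightarrow> 'm set" where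
  "monos_into C X = {m. monic C m \<and> Cod C m = X}"

definition factors_through :: "('o, 'm) cat \<Rightarrow> 'm \<Rightarrow> 'm \<Rightarrow> bool" where
  "factors_through C m n \<longleftrightarrow> (\<exists>h\<in>hom_set C (Dom C m) (Dom C n). n \<cdot>\<^bsub>C\<^esub> h = m)"

definition subobject_rel :: "('o, 'm) cat \<Rightarrow> 'o \<Rightarrow> ('m \<times> 'm) set" where
  "subobject_rel C X = {(m, n). m \<in> monos_into C X \<and> n \<in> monos_into C X \<and>
     factors_through C m n \<and> factors_through C n m}"

text \<open>The poset of subobjects of \<open>X\<close>; its elements are equivalence classes of monomorphisms.\<close>

definition Sub :: "('o, 'm) cat \<Rightarrow> 'o \<Rightarrow> 'm set gorder" where
  "Sub C X = \<lparr>carrier = monos_into C X // subobject_rel C X, eq = (=),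
     le = (\<lambda>S T. \<exists>m\<in>S. \<exists>n\<in>T. factors_through C m n)\<rparr>"

text \<open>\<open>T\<close> is a complement of \<open>S\<close> if \<open>S \<and> T\<close> is the bottom and \<open>S \<or> T\<close> the top of \<open>Sub C X\<close>.\<close>

definition is_complement :: "('o, 'm) cat \<Rightarrow> 'o \<Rightarrow> 'm set \<Rightarrow> 'm set \<Rightarrow> bool" where
  "is_complement C X S T \<longleftrightarrow>
     S \<in> carrier (Sub C X) \<and> T \<in> carrier (Sub C X) \<and>
     (\<exists>b. least (Sub C X) b (carrier (Sub C X)) \<and> greatest (Sub C X) b (Lower (Sub C X) {S, T})) \<and>
     (\<exists>t. greatest (Sub C X) t (carrier (Sub C X)) \<and> least (Sub C X) t (Upper (Sub C X) {S, T}))"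

definition Sub_c :: "('o, 'm) cat \<Rightarrow> 'o \<Rightarrow> 'm set set" where
  "Sub_c C X = {S \<in> carrier (Sub C X). \<exists>T. is_complement C X S T}"

definition connected_object :: "('o, 'm) cat \<Rightarrow> 'o \<Rightarrow> bool" where
  "connected_object C X \<longleftrightarrow> X \<in> Ob C \<and> card (Sub_c C X) = 2"

definition is_diagonal :: "('o, 'm) cat \<Rightarrow> 'o \<Rightarrow> 'o \<Rightarrow> 'm \<Rightarrow> bool" where
  "is_diagonal C X P d \<longleftrightarrow> d \<in> hom_set C X P \<and>
     (\<exists>p q. is_product C X X P p q \<and> p \<cdot>\<^bsub>C\<^esub> d = Id C X \<and> q \<cdot>\<^bsub>C\<^esub> d = Id C X)"

definition decidable :: "('o, 'm) cat \<Rightarrow> 'o \<Rightarrow> bool" where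
  "decidable C X \<longleftrightarrow> X \<in> Ob C \<and>
     (\<exists>P d. is_diagonal C X P d \<and> subobject_rel C P `` {d} \<in> Sub_c C P)"


section \<open>The axioms (NS) and (DQO)\<close>

definition has_global_element :: "('o, 'm) cat \<Rightarrow> 'o \<Rightarrow> bool" where
  "has_global_element C X \<longleftrightarrow> (\<exists>I x. terminal C I \<and> x \<in> hom_set C I X)"

text \<open>
  The alternative in (NS) is exclusive. Since an initial object with a global element makes the
  topos degenerate, this says that the topos is nondegenerate and that every object is initial or
  has a global element.
\<close>
definition NS :: "('o, 'm) cat \<Rightarrow> bool" where
  "NS C \<longleftrightarrow> (\<forall>X\<in>Ob C. (initial C X \<or> has_global_element C X) \<and>
     \<not> (initial C X \<and> has_global_element C X))"

definition is_two :: "('o, 'm) cat \<Rightarrow> 'o \<Rightarrow> bool" where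
  "is_two C T \<longleftrightarrow> (\<exists>I i j. terminal C I \<and> is_coproduct C I I T i j)"

definition decidable_quotient :: "('o, 'm) cat \<Rightarrow> 'o \<Rightarrow> 'm \<Rightarrow> bool" where
  "decidable_quotient C X p \<longleftrightarrow> epic C p \<and> Dom C p = X \<and> decidable C (Cod C p) \<and>
     (\<forall>T. is_two C T \<longrightarrow>
        (\<forall>f\<in>hom_set C X T. \<exists>!g. g \<in> hom_set C (Cod C p) T \<and> g \<cdot>\<^bsub>C\<^esub> p = f))"

definition DQO :: "('o, 'm) cat \<Rightarrow> bool" where
  "DQO C \<longleftrightarrow> (\<forall>X\<in>Ob C.
     (\<exists>p. decidable_quotient C X p) \<and>
     (\<forall>p p'. decidable_quotient C X p \<longrightarrow> decidable_quotient C X p' \<longrightarrow>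
        (\<exists>i\<in>hom_set C (Cod C p) (Cod C p'). iso_arrow C i \<and> i \<cdot>\<^bsub>C\<^esub> p = p')))"

end

theory Submission
  imports Defs
begin

text \<open>
  Pulling back subobjects along \<open>f\<close> has a right adjoint \<open>\<forall>\<^sub>f\<close>, so complements are stable under
  pullback. If \<open>X\<close> is connected, then \<open>\<Pi>X\<close> is not initial and has a global element \<open>x\<close> by (NS).
  The pullback of the diagonal of \<open>\<Pi>X\<close> along \<open>(p, x!) : X \<rightarrow> \<Pi>X \<times> \<Pi>X\<close> is complemented, hence bottom
  or top. If it were bottom, then \<open>p\<close> would factor through the complement of \<open>x\<close>, which is
  impossible as \<open>p\<close> is epic. So it is top, which means \<open>p = x!\<close>, and \<open>x\<close> is invertible since \<open>p\<close> is
  epic. Conversely, a complementary pair on \<open>X\<close> gives an arrow \<open>X \<rightarrow> 2\<close>: lift the characteristic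
  arrow along the monomorphism \<open>[true, false] : 2 \<rightarrow> \<Omega>\<close>. If \<open>\<Pi>X = 1\<close>, this arrow factors through a
  global element of \<open>2\<close>, and by (NS) there are only two of those.
\<close>

section \<open>Arrows and subobjects in a category\<close>

context category
begin

abbreviation hom :: "'o \<Rightarrow> 'o \<Rightarrow> 'm set" where
  "hom \<equiv> hom_set C"

text \<open>The left-hand side may be any arrow, not only a monomorphism:
  \<open>z \<preceq> m\<close> says that the generalized element \<open>z\<close> belongs to the
  subobject \<open>m\<close>. Most proofs below chase such elements.\<close>

abbreviation le_sub :: "'m \<Rightarrow> 'm \<Rightarrow> bool"  (infix \<open>\<preceq>\<close> 50) where
  "f \<preceq> m \<equiv> factors_through C f m"

lemma homD:
  assumes "f \<in> hom X Y"
  shows "f \<in> Mor C" "Dom C f = X" "Cod C f = Y" "X \<in> Ob C" "Y \<in> Ob C"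
  using assms dom_in_Ob cod_in_Ob by (auto simp: hom_set_def)

lemma in_hom_iff: "f \<in> hom X Y \<longleftrightarrow> f \<in> Mor C \<and> Dom C f = X \<and> Cod C f = Y"
  by (simp add: hom_set_def)

lemma Id_Mor [simp]:
  assumes "X \<in> Ob C"
  shows "Id C X \<in> Mor C" "Dom C (Id C X) = X" "Cod C (Id C X) = X"
  using id_in_hom[OF assms] by (auto simp: hom_set_def)

section \<open>Monomorphisms and membership of generalized elements in subobjects\<close>

lemma monicI:
  assumes "m \<in> hom S X"
    and "\<And>T u v. u \<in> hom T S \<Longrightarrow> v \<in> hom T S \<Longrightarrow> m \<cdot> u = m \<cdot> v \<Longrightarrow> u = v"
  shows "m \<in> monos_into C X"
  using assms by (auto simp: monos_into_def monic_def in_hom_iff)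

lemma monos_into_hom: "m \<in> monos_into C X \<Longrightarrow> m \<in> hom (Dom C m) X"
  by (auto simp: monos_into_def monic_def in_hom_iff)

lemma mono_cancel:
  assumes "m \<in> monos_into C X" "u \<in> hom T (Dom C m)" "v \<in> hom T (Dom C m)" "m \<cdot> u = m \<cdot> v"
  shows "u = v"
  using assms homD(4)[OF assms(2)] by (auto simp: monos_into_def monic_def)

lemma Id_monos_into: "X \<in> Ob C \<Longrightarrow> Id C X \<in> monos_into C X"
  by (rule monicI[OF id_in_hom]) (simp_all add: comp_id_left)

lemma comp_monos_into:
  assumes m: "m \<in> monos_into C X" and n: "n \<in> monos_into C (Dom C m)"
  shows "m \<cdot> n \<in> monos_into C X"
proof (rule monicI)
  note mh = monos_into_hom[OF m] and nh = monos_into_hom[OF n]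
  show "m \<cdot> n \<in> hom (Dom C n) X" using mh nh comp_in_hom by blast
  fix T u v
  assume u: "u \<in> hom T (Dom C n)" and v: "v \<in> hom T (Dom C n)" and eq: "(m \<cdot> n) \<cdot> u = (m \<cdot> n) \<cdot> v"
  have "m \<cdot> (n \<cdot> u) = m \<cdot> (n \<cdot> v)"
    using eq comp_assoc[OF u nh mh] comp_assoc[OF v nh mh] by simp
  then have "n \<cdot> u = n \<cdot> v" using mono_cancel[OF m] comp_in_hom nh u v by blast
  then show "u = v" using mono_cancel[OF n] u v by blast
qed

text \<open>The retraction \<open>r\<close> cancels \<open>s\<close>. This applies to graphs and
  diagonals, which are split by a product projection.\<close>

lemma split_monos_into:
  assumes s: "s \<in> hom S X" and r: "r \<in> hom X S" and rs: "r \<cdot> s = Id C S"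
  shows "s \<in> monos_into C X"
proof (rule monicI[OF s])
  fix T u v assume u: "u \<in> hom T S" and v: "v \<in> hom T S" and eq: "s \<cdot> u = s \<cdot> v"
  have "u = r \<cdot> (s \<cdot> u)" using comp_assoc[OF u s r] rs comp_id_left[OF u] by simp
  also have "\<dots> = v" using eq comp_assoc[OF v s r] rs comp_id_left[OF v] by simp
  finally show "u = v" .
qed

lemma factorsI: "h \<in> hom (Dom C f) (Dom C m) \<Longrightarrow> m \<cdot> h = f \<Longrightarrow> f \<preceq> m"
  by (auto simp: factors_through_def)

lemma factors_homI: "f \<in> hom T X \<Longrightarrow> h \<in> hom T (Dom C m) \<Longrightarrow> m \<cdot> h = f \<Longrightarrow> f \<preceq> m"
  using factorsI homD(2) by metis

lemma factorsE:
  assumes "f \<preceq> m" "f \<in> hom T X"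
  obtains h where "h \<in> hom T (Dom C m)" "m \<cdot> h = f"
  using assms by (auto simp: factors_through_def in_hom_iff)

lemma factors_refl: "f \<in> hom T X \<Longrightarrow> f \<preceq> f"
  using factorsI[of "Id C T"] comp_id_right homD id_in_hom by metis

lemma factors_trans:
  assumes "f \<preceq> m" "m \<preceq> n" "f \<in> hom T X" "m \<in> hom S X" "n \<in> hom R X"
  shows "f \<preceq> n"
proof -
  obtain h where h: "h \<in> hom T (Dom C m)" "m \<cdot> h = f" using factorsE assms by blast
  obtain k where k: "k \<in> hom S (Dom C n)" "n \<cdot> k = m" using factorsE assms by blast
  have n: "n \<in> hom (Dom C n) X" using assms(5) homD(2) by metis
  show ?thesis
    using factorsI[of "k \<cdot> h" f n] comp_in_hom[OF h(1), of k] comp_assoc[OF h(1) _ n, of k] h k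
      homD(2)[OF assms(3)] homD(2)[OF assms(4)] by simp
qed

lemma factors_comp:
  assumes "f \<preceq> m" "f \<in> hom T X" "m \<in> hom S X" "g \<in> hom R T"
  shows "f \<cdot> g \<preceq> m"
proof -
  obtain h where h: "h \<in> hom T (Dom C m)" "m \<cdot> h = f" using factorsE assms by blast
  have m: "m \<in> hom (Dom C m) X" using assms(3) homD(2) by metis
  show ?thesis
    using factorsI[of "h \<cdot> g" "f \<cdot> g" m] comp_in_hom[OF assms(4) h(1)]
      comp_assoc[OF assms(4) h(1) m] h homD(2)[OF comp_in_hom[OF assms(4,2)]] by simp
qed

section \<open>Initial and terminal objects, products, equalizers\<close>

lemma initial_unique:
  assumes "initial C Z" "u \<in> hom Z X" "v \<in> hom Z X"
  shows "u = v"
  using assms homD(5) unfolding initial_def by blast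

lemma initial_arrow:
  assumes "initial C Z" "X \<in> Ob C"
  obtains u where "u \<in> hom Z X"
  using assms unfolding initial_def by blast

lemma terminal_unique:
  assumes "terminal C I" "u \<in> hom X I" "v \<in> hom X I"
  shows "u = v"
  using assms homD(4) unfolding terminal_def by blast

lemma terminal_arrow:
  assumes "terminal C I" "X \<in> Ob C"
  obtains u where "u \<in> hom X I"
  using assms unfolding terminal_def by blast

lemma terminal_mono: "terminal C I \<Longrightarrow> x \<in> hom I X \<Longrightarrow> x \<in> monos_into C X"
  by (metis monicI terminal_unique)

lemma initial_factors:
  assumes T: "initial C T" and f: "f \<in> hom T X" and m: "m \<in> hom S X"
  shows "f \<preceq> m"
proof -
  obtain h where h: "h \<in> hom T S" using initial_arrow[OF T homD(4)[OF m]] by blast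
  show ?thesis
    using factors_homI[OF f _ initial_unique[OF T comp_in_hom[OF h m] f]] h homD(2)[OF m] by simp
qed

lemma productE:
  assumes "is_product C X Y P p q" "f \<in> hom T X" "g \<in> hom T Y"
  obtains h where "h \<in> hom T P" "p \<cdot> h = f" "q \<cdot> h = g"
  using assms homD(4) unfolding is_product_def by metis

lemma product_eqI:
  assumes P: "is_product C X Y P p q" and h: "h \<in> hom T P" "k \<in> hom T P"
    and eq: "p \<cdot> h = p \<cdot> k" "q \<cdot> h = q \<cdot> k"
  shows "h = k"
proof -
  have p: "p \<in> hom P X" and q: "q \<in> hom P Y" using P by (auto simp: is_product_def)
  have "\<exists>!l. l \<in> hom T P \<and> p \<cdot> l = p \<cdot> k \<and> q \<cdot> l = q \<cdot> k"
    using P comp_in_hom[OF h(2) p] comp_in_hom[OF h(2) q] homD(4)[OF h(2)]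
    unfolding is_product_def by blast
  then show ?thesis using h eq by blast
qed

text \<open>The second part turns an equation of arrows into membership in a subobject. Two arrows
  can then be proved equal by showing that their equalizer is everything, and this can be checked
  piecewise on a cover.\<close>

lemma equalizer_monos_into:
  assumes e: "is_equalizer C f g e" and f: "f \<in> hom X Y" and g: "g \<in> hom X Y"
  shows "e \<in> monos_into C X"
    and "z \<in> hom Z X \<Longrightarrow> z \<preceq> e \<longleftrightarrow> f \<cdot> z = g \<cdot> z"
proof -
  have eh: "e \<in> hom (Dom C e) X" and eq: "f \<cdot> e = g \<cdot> e"
    using e homD(2)[OF f] by (auto simp: is_equalizer_def)
  have ex1: "\<exists>!h. h \<in> hom T (Dom C e) \<and> e \<cdot> h = u"
    if "u \<in> hom T X" "f \<cdot> u = g \<cdot> u" for T u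
    using e that homD(4)[OF that(1)] homD(2)[OF f] unfolding is_equalizer_def by blast
  have equ: "f \<cdot> (e \<cdot> h) = g \<cdot> (e \<cdot> h)" if "h \<in> hom T (Dom C e)" for T h
    using eq comp_assoc[OF that eh f] comp_assoc[OF that eh g] by simp
  show "e \<in> monos_into C X"
  proof (rule monicI[OF eh])
    fix T u v assume "u \<in> hom T (Dom C e)" "v \<in> hom T (Dom C e)" "e \<cdot> u = e \<cdot> v"
    then show "u = v" using ex1[OF comp_in_hom[OF _ eh] equ, of u T] by auto
  qed
  show "z \<preceq> e \<longleftrightarrow> f \<cdot> z = g \<cdot> z" if z: "z \<in> hom Z X"
  proof
    assume "z \<preceq> e"
    then show "f \<cdot> z = g \<cdot> z" using equ z by (metis factorsE)
  next
    assume "f \<cdot> z = g \<cdot> z"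
    then show "z \<preceq> e" using ex1[OF z] homD(2)[OF z] by (auto simp: factors_through_def)
  qed
qed

text \<open>
  For subobjects these say that the meet is the bottom and the join the top, without a choice of
  meets and joins; the first also makes sense for arbitrary arrows.
\<close>

definition disjoint :: "'m \<Rightarrow> 'm \<Rightarrow> bool" where
  "disjoint s t \<longleftrightarrow>
     (\<forall>T. \<forall>u\<in>hom T (Dom C s). \<forall>v\<in>hom T (Dom C t). s \<cdot> u = t \<cdot> v \<longrightarrow> initial C T)"

definition covers :: "'o \<Rightarrow> 'm \<Rightarrow> 'm \<Rightarrow> bool" where
  "covers X s t \<longleftrightarrow> (\<forall>w\<in>monos_into C X. s \<preceq> w \<longrightarrow> t \<preceq> w \<longrightarrow> Id C X \<preceq> w)"

definition complementary :: "'o \<Rightarrow> 'm \<Rightarrow> 'm \<Rightarrow> bool" where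
  "complementary X s t \<longleftrightarrow> s \<in> monos_into C X \<and> t \<in> monos_into C X \<and> disjoint s t \<and> covers X s t"

lemma disjointD:
  assumes "disjoint s t" "u \<in> hom T (Dom C s)" "v \<in> hom T (Dom C t)" "s \<cdot> u = t \<cdot> v"
  shows "initial C T"
  using assms unfolding disjoint_def by blast

lemma disjoint_sym: "disjoint s t \<Longrightarrow> disjoint t s"
  unfolding disjoint_def by metis

lemma covers_sym: "covers X s t \<Longrightarrow> covers X t s"
  unfolding covers_def by blast

lemma complementary_sym: "complementary X s t \<Longrightarrow> complementary X t s"
  unfolding complementary_def using disjoint_sym covers_sym by blast

text \<open>If both injections factor through \<open>w\<close>, the copairing \<open>h\<close> of
  the two factors satisfies \<open>w \<cdot> h = Id C S\<close>, since both sides restrict to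
  \<open>i\<close> and \<open>j\<close>.\<close>

lemma coproduct_covers:
  assumes S: "is_coproduct C X Y S i j"
  shows "covers S i j"
  unfolding covers_def
proof (intro ballI impI)
  fix w assume w: "w \<in> monos_into C S" and iw: "i \<preceq> w" and jw: "j \<preceq> w"
  note wh = monos_into_hom[OF w]
  have i: "i \<in> hom X S" and j: "j \<in> hom Y S" using S by (simp_all add: is_coproduct_def)
  note SO = homD(5)[OF i]
  have cop: "\<exists>!h. h \<in> hom S T \<and> h \<cdot> i = f \<and> h \<cdot> j = g" if "f \<in> hom X T" "g \<in> hom Y T" for T f g
    using S that homD(5)[OF that(1)] unfolding is_coproduct_def by blast
  obtain i' where i': "i' \<in> hom X (Dom C w)" "w \<cdot> i' = i" using factorsE[OF iw i] by blast
  obtain j' where j': "j' \<in> hom Y (Dom C w)" "w \<cdot> j' = j" using factorsE[OF jw j] by blast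
  obtain h where h: "h \<in> hom S (Dom C w)" "h \<cdot> i = i'" "h \<cdot> j = j'"
    using cop[OF i'(1) j'(1)] by blast
  have "(w \<cdot> h) \<cdot> i = i" "(w \<cdot> h) \<cdot> j = j"
    using comp_assoc[OF i h(1) wh] comp_assoc[OF j h(1) wh] h i' j' by simp_all
  then have "w \<cdot> h = Id C S"
    using cop[OF i j] comp_in_hom[OF h(1) wh] id_in_hom[OF SO] comp_id_left[OF i] comp_id_left[OF j]
    by metis
  then show "Id C S \<preceq> w" using factors_homI[OF id_in_hom[OF SO] h(1)] by simp
qed

section \<open>The poset of subobjects through representing monomorphisms\<close>

lemma equiv_subobject_rel: "equiv (monos_into C X) (subobject_rel C X)"
proof (rule equivI)
  show "refl_on (monos_into C X) (subobject_rel C X)"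
    using factors_refl[OF monos_into_hom] by (auto simp: refl_on_def subobject_rel_def)
  show "sym (subobject_rel C X)" by (auto simp: sym_def subobject_rel_def)
  show "trans (subobject_rel C X)"
  proof (rule transI)
    fix l m n assume lm: "(l, m) \<in> subobject_rel C X" and mn: "(m, n) \<in> subobject_rel C X"
    then have h: "l \<in> hom (Dom C l) X" "m \<in> hom (Dom C m) X" "n \<in> hom (Dom C n) X"
      by (auto simp: subobject_rel_def intro: monos_into_hom)
    show "(l, n) \<in> subobject_rel C X"
      using lm mn factors_trans[OF _ _ h] factors_trans[OF _ _ h(3,2,1)]
      by (auto simp: subobject_rel_def)
  qed
  show "subobject_rel C X \<subseteq> monos_into C X \<times> monos_into C X"
    by (auto simp: subobject_rel_def)
qed

abbreviation sub_class :: "'o \<Rightarrow> 'm \<Rightarrow> 'm set" where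
  "sub_class X m \<equiv> subobject_rel C X `` {m}"

lemma sub_class_in_carrier: "m \<in> monos_into C X \<Longrightarrow> sub_class X m \<in> carrier (Sub C X)"
  by (auto simp: Sub_def intro: quotientI)

lemma carrier_SubE:
  assumes "S \<in> carrier (Sub C X)"
  obtains m where "m \<in> monos_into C X" "S = sub_class X m"
  using assms by (auto simp: Sub_def elim: quotientE)

lemma sub_class_eq_iff:
  assumes "m \<in> monos_into C X" "n \<in> monos_into C X"
  shows "sub_class X m = sub_class X n \<longleftrightarrow> m \<preceq> n \<and> n \<preceq> m"
  using eq_equiv_class_iff[OF equiv_subobject_rel assms] assms by (simp add: subobject_rel_def)

lemma le_Sub_iff:
  assumes m: "m \<in> monos_into C X" and n: "n \<in> monos_into C X"
  shows "sub_class X m \<sqsubseteq>\<^bsub>Sub C X\<^esub> sub_class X n \<longleftrightarrow> m \<preceq> n"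
proof
  assume "m \<preceq> n"
  moreover have "m \<in> sub_class X m" "n \<in> sub_class X n"
    using m n equiv_class_self[OF equiv_subobject_rel] by auto
  ultimately show "sub_class X m \<sqsubseteq>\<^bsub>Sub C X\<^esub> sub_class X n"
    by (auto simp: Sub_def)
next
  assume "sub_class X m \<sqsubseteq>\<^bsub>Sub C X\<^esub> sub_class X n"
  then obtain m' n' where "(m, m') \<in> subobject_rel C X" "(n, n') \<in> subobject_rel C X" "m' \<preceq> n'"
    by (auto simp: Sub_def)
  then have h: "m \<preceq> m'" "m' \<preceq> n'" "n' \<preceq> n" "m' \<in> monos_into C X" "n' \<in> monos_into C X"
    by (auto simp: subobject_rel_def)
  show "m \<preceq> n"
    using factors_trans[OF factors_trans[OF h(1,2)] h(3)] h m n monos_into_hom by blast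
qed

section \<open>Pullbacks and inverse images of subobjects\<close>

lemma pullbackD:
  assumes "is_pullback C f g p q" "f \<in> hom X Z" "g \<in> hom Y Z"
  shows "p \<in> hom (Dom C p) X" "q \<in> hom (Dom C p) Y" "f \<cdot> p = g \<cdot> q"
  using assms(1) homD(2)[OF assms(2)] homD(2)[OF assms(3)] by (auto simp: is_pullback_def)

lemma pullback_ex1:
  assumes "is_pullback C f g p q" "f \<in> hom X Z" "g \<in> hom Y Z"
    and "u \<in> hom T X" "v \<in> hom T Y" "f \<cdot> u = g \<cdot> v"
  shows "\<exists>!h. h \<in> hom T (Dom C p) \<and> p \<cdot> h = u \<and> q \<cdot> h = v"
  using assms(1,4-) homD(4)[OF assms(4)] unfolding is_pullback_def homD(2)[OF assms(2)] homD(2)[OF assms(3)]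
  by blast

text \<open>Here \<open>n\<close> is the inverse image of \<open>m\<close> under \<open>f\<close>;
  later proofs mostly use this description by elements in place of the universal property.\<close>

lemma pullback_mono:
  assumes pb: "is_pullback C f m n q" and f: "f \<in> hom X Y" and m: "m \<in> monos_into C Y"
  shows "n \<in> monos_into C X"
    and "z \<in> hom T X \<Longrightarrow> z \<preceq> n \<longleftrightarrow> f \<cdot> z \<preceq> m"
proof -
  note mh = monos_into_hom[OF m]
  note n = pullbackD(1)[OF pb f mh] and q = pullbackD(2)[OF pb f mh] and sq = pullbackD(3)[OF pb f mh]
  have s: "f \<cdot> (n \<cdot> w) = m \<cdot> (q \<cdot> w)" if w: "w \<in> hom T (Dom C n)" for T w
    using comp_assoc[OF w n f] comp_assoc[OF w q mh] sq by simp
  show "n \<in> monos_into C X"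
  proof (rule monicI[OF n])
    fix T u v assume u: "u \<in> hom T (Dom C n)" and v: "v \<in> hom T (Dom C n)" and eq: "n \<cdot> u = n \<cdot> v"
    \<comment> \<open>Equal first legs have equal images in \<open>Y\<close>, so the monic
      \<open>m\<close> equates the second legs too; uniqueness in the pullback then applies.\<close>
    have "q \<cdot> u = q \<cdot> v"
      by (rule mono_cancel[OF m comp_in_hom[OF u q] comp_in_hom[OF v q]])
        (use s[OF u] s[OF v] eq in simp)
    then show "u = v"
      using pullback_ex1[OF pb f mh comp_in_hom[OF u n] comp_in_hom[OF u q] s[OF u]] u v eq by metis
  qed
  show "z \<preceq> n \<longleftrightarrow> f \<cdot> z \<preceq> m" if z: "z \<in> hom T X"
  proof
    assume "z \<preceq> n"
    then obtain h where h: "h \<in> hom T (Dom C n)" "n \<cdot> h = z"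
      using factorsE[OF _ z] by blast
    show "f \<cdot> z \<preceq> m"
      using factorsI[of "q \<cdot> h"] comp_in_hom[OF h(1) q] homD(2)[OF comp_in_hom[OF z f]] s[OF h(1)] h
      by simp
  next
    assume "f \<cdot> z \<preceq> m"
    then obtain h where h: "h \<in> hom T (Dom C m)" "m \<cdot> h = f \<cdot> z"
      using factorsE[OF _ comp_in_hom[OF z f]] by blast
    obtain k where "k \<in> hom T (Dom C n)" "n \<cdot> k = z"
      using pullback_ex1[OF pb f mh z h(1) h(2)[symmetric]] by blast
    then show "z \<preceq> n" using factorsI[of k z n] homD(2)[OF z] by simp
  qed
qed

end

section \<open>Pullback stability of complements in a topos\<close>

context elementary_topos
begin

section \<open>Existence of pullbacks and strictness of the initial object\<close>

lemma ex_pullback: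
  assumes f: "f \<in> hom X Z" and g: "g \<in> hom Y Z"
  shows "\<exists>p q. is_pullback C f g p q"
proof -
  obtain W a b where W: "is_product C X Y W a b"
    using ex_product[OF homD(4)[OF f] homD(4)[OF g]] by blast
  then have a: "a \<in> hom W X" and b: "b \<in> hom W Y" by (auto simp: is_product_def)
  have fa: "f \<cdot> a \<in> hom W Z" and gb: "g \<cdot> b \<in> hom W Z"
    using comp_in_hom[OF a f] comp_in_hom[OF b g] .
  \<comment> \<open>The pullback is the part of the product on which the two composites into
    \<open>Z\<close> agree.\<close>
  obtain e where e: "is_equalizer C (f \<cdot> a) (g \<cdot> b) e"
    using ex_equalizer[OF fa gb] by blast
  note em = equalizer_monos_into[OF e fa gb]
  have eh: "e \<in> hom (Dom C e) W" using monos_into_hom[OF em(1)] .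
  define P where "P = Dom C e"
  have p: "a \<cdot> e \<in> hom P X" and q: "b \<cdot> e \<in> hom P Y"
    using comp_in_hom[OF eh a] comp_in_hom[OF eh b] P_def by simp_all
  have sq: "f \<cdot> (a \<cdot> e) = g \<cdot> (b \<cdot> e)"
    using em(2)[OF eh] factors_refl[OF eh] comp_assoc[OF eh a f] comp_assoc[OF eh b g] by simp
  have ex: "\<exists>h. h \<in> hom T P \<and> (a \<cdot> e) \<cdot> h = u \<and> (b \<cdot> e) \<cdot> h = v"
    if u: "u \<in> hom T X" and v: "v \<in> hom T Y" and uv: "f \<cdot> u = g \<cdot> v" for T u v
  proof -
    obtain k where k: "k \<in> hom T W" "a \<cdot> k = u" "b \<cdot> k = v"
      using productE[OF W u v] by blast
    have "(f \<cdot> a) \<cdot> k = (g \<cdot> b) \<cdot> k"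
      using uv k comp_assoc[OF k(1) a f] comp_assoc[OF k(1) b g] by simp
    then obtain h where h: "h \<in> hom T P" "e \<cdot> h = k"
      using em(2)[OF k(1)] factorsE[OF _ k(1), of e] P_def by blast
    then show ?thesis
      using k comp_assoc[OF _ eh a] comp_assoc[OF _ eh b] P_def by metis
  qed
  have un: "h = k" if h: "h \<in> hom T P" and k: "k \<in> hom T P"
    and eq: "(a \<cdot> e) \<cdot> h = (a \<cdot> e) \<cdot> k" "(b \<cdot> e) \<cdot> h = (b \<cdot> e) \<cdot> k" for T h k
  proof -
    have "e \<cdot> h = e \<cdot> k"
    proof (rule product_eqI[OF W])
      note h' = h[unfolded P_def] and k' = k[unfolded P_def]
      show "e \<cdot> h \<in> hom T W" "e \<cdot> k \<in> hom T W"
        using comp_in_hom[OF h' eh] comp_in_hom[OF k' eh] .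
      show "a \<cdot> (e \<cdot> h) = a \<cdot> (e \<cdot> k)" "b \<cdot> (e \<cdot> h) = b \<cdot> (e \<cdot> k)"
        using eq comp_assoc[OF h' eh a] comp_assoc[OF k' eh a] comp_assoc[OF h' eh b]
          comp_assoc[OF k' eh b] by simp_all
    qed
    then show ?thesis using mono_cancel[OF em(1) h[unfolded P_def] k[unfolded P_def]] by simp
  qed
  have "is_pullback C f g (a \<cdot> e) (b \<cdot> e)"
    unfolding is_pullback_def homD(2)[OF p] homD(2)[OF f] homD(2)[OF g]
  proof (intro conjI ballI impI p q sq)
    fix T u v assume "u \<in> hom T X" "v \<in> hom T Y" "f \<cdot> u = g \<cdot> v"
    from ex[OF this] obtain h where "h \<in> hom T P" "(a \<cdot> e) \<cdot> h = u" "(b \<cdot> e) \<cdot> h = v"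
      by blast
    then show "\<exists>!h. h \<in> hom T P \<and> (a \<cdot> e) \<cdot> h = u \<and> (b \<cdot> e) \<cdot> h = v"
      using un by (intro ex1I[of _ h]) metis+
  qed
  then show ?thesis by blast
qed

text \<open>Arrows from \<open>Z \<times> A\<close> to \<open>B\<close> correspond to arrows from
  \<open>Z\<close> to the exponential, and there is only one of those. The arrow \<open>f\<close>
  gives a section \<open>k\<close> of the projection \<open>Z \<times> A \<rightarrow> A\<close>, so
  an arrow out of \<open>A\<close> is determined by its composite with that projection.\<close>

lemma strict_initial:
  assumes Z: "initial C Z" and f: "f \<in> hom A Z"
  shows "initial C A"
proof -
  have A: "A \<in> Ob C" and ZO: "Z \<in> Ob C" using homD(4,5)[OF f] .
  obtain Q r s where Q: "is_product C Z A Q r s" using ex_product[OF ZO A] by blast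
  then have r: "r \<in> hom Q Z" and s: "s \<in> hom Q A" by (auto simp: is_product_def)
  obtain k where k: "k \<in> hom A Q" "s \<cdot> k = Id C A"
    using productE[OF Q f id_in_hom[OF A]] by blast
  have "\<exists>!h. h \<in> hom A B" if B: "B \<in> Ob C" for B
  proof -
    obtain E P p q ev where E: "is_exponential C A B E P p q ev"
      using ex_exponential[OF A B] by blast
    then have P: "is_product C E A P p q" and ev: "ev \<in> hom P B"
      and tr: "\<And>f. f \<in> hom Q B \<Longrightarrow> \<exists>g. g \<in> hom Z E \<and>
        (\<exists>k\<in>hom Q P. p \<cdot> k = g \<cdot> r \<and> q \<cdot> k = s \<and> ev \<cdot> k = f)"
      using Q unfolding is_exponential_def by auto blast
    have p: "p \<in> hom P E" using P by (simp add: is_product_def)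
    obtain g where g: "g \<in> hom Z E" using initial_arrow[OF Z homD(5)[OF p]] by blast
    obtain l where l: "l \<in> hom Q P" "p \<cdot> l = g \<cdot> r" "q \<cdot> l = s"
      using productE[OF P comp_in_hom[OF r g] s] by blast
    \<comment> \<open>The transpose of \<open>h\<close> is an arrow out of the initial object, hence
      equal to \<open>g\<close>; so \<open>h\<close> is the evaluation after \<open>l\<close>,
      whatever \<open>h\<close> is.\<close>
    have un: "h = ev \<cdot> l" if h: "h \<in> hom Q B" for h
    proof -
      obtain g' k' where g': "g' \<in> hom Z E" and k': "k' \<in> hom Q P" "p \<cdot> k' = g' \<cdot> r"
        "q \<cdot> k' = s" "ev \<cdot> k' = h" using tr[OF h] by blast
      have "k' = l" using product_eqI[OF P k'(1) l(1)] k' l initial_unique[OF Z g g'] by simp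
      then show ?thesis using k' by simp
    qed
    have "h = (ev \<cdot> l) \<cdot> k" if h: "h \<in> hom A B" for h
      using un[OF comp_in_hom[OF s h]] comp_assoc[OF k(1) s h] k h comp_id_right[OF h] by simp
    moreover have "(ev \<cdot> l) \<cdot> k \<in> hom A B"
      using comp_in_hom[OF k(1) comp_in_hom[OF l(1) ev]] .
    ultimately show ?thesis by blast
  qed
  then show ?thesis using A by (simp add: initial_def)
qed

text \<open>By strictness the domain of any arrow into \<open>Z\<close> is itself initial, so
  parallel arrows into \<open>Z\<close> are equal.\<close>

lemma initial_mono:
  assumes Z: "initial C Z" and z: "z \<in> hom Z X"
  shows "z \<in> monos_into C X"
  using monicI[OF z] initial_unique[OF strict_initial[OF Z]] by blast

section \<open>The subobject classifier, balancedness and universal quantification along an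
  arrow\<close>

lemma truth_mono: "is_subobject_classifier C Om t \<Longrightarrow> t \<in> monos_into C Om"
  unfolding is_subobject_classifier_def by (metis terminal_mono)

lemma classifying_arrow:
  assumes cl: "is_subobject_classifier C Om t" and m: "m \<in> monos_into C X"
  shows "\<exists>c\<in>hom X Om. \<forall>Z. \<forall>z\<in>hom Z X. c \<cdot> z \<preceq> t \<longleftrightarrow> z \<preceq> m"
proof -
  obtain c u where c: "c \<in> hom X Om" and pb: "is_pullback C c t m u"
    using cl m unfolding is_subobject_classifier_def monos_into_def by blast
  then show ?thesis using pullback_mono(2)[OF pb c truth_mono[OF cl]] by blast
qed

text \<open>An arrow into \<Omega> is determined by the generalized elements that it makes true.
  These elements determine the pullback \<open>n\<close> of \<open>t\<close> along \<open>c\<close>;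
  the same \<open>n\<close> is shown to be a pullback along \<open>c'\<close>, and characteristic
  arrows are unique.\<close>

lemma classifier_eqI:
  assumes cl: "is_subobject_classifier C Om t" and c: "c \<in> hom X Om" and c': "c' \<in> hom X Om"
    and eq: "\<And>Z z. z \<in> hom Z X \<Longrightarrow> c \<cdot> z \<preceq> t \<longleftrightarrow> c' \<cdot> z \<preceq> t"
  shows "c = c'"
proof -
  note tm = truth_mono[OF cl]
  note t = monos_into_hom[OF tm]
  have ter: "terminal C (Dom C t)" using cl by (simp add: is_subobject_classifier_def)
  obtain n q where pb: "is_pullback C c t n q" using ex_pullback[OF c t] by blast
  note n = pullback_mono(1)[OF pb c tm] and fac = pullback_mono(2)[OF pb c tm]
  note nh = monos_into_hom[OF n]
  obtain q' where q': "q' \<in> hom (Dom C n) (Dom C t)" "t \<cdot> q' = c' \<cdot> n"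
    using fac[OF nh] factors_refl[OF nh] eq[OF nh] factorsE[OF _ comp_in_hom[OF nh c'], of t]
      by blast
  have "is_pullback C c' t n q'"
    unfolding is_pullback_def homD(2)[OF c']
  proof (intro conjI ballI impI nh q'(1) q'(2)[symmetric])
    fix T u v assume u: "u \<in> hom T X" and v: "v \<in> hom T (Dom C t)" and uv: "c' \<cdot> u = t \<cdot> v"
    have "c' \<cdot> u \<preceq> t"
      using factorsI[of v] v uv homD(2)[OF comp_in_hom[OF u c']] by simp
    then obtain h where h: "h \<in> hom T (Dom C n)" "n \<cdot> h = u"
      using fac[OF u] eq[OF u] factorsE[OF _ u, of n] by blast
    then show "\<exists>!h. h \<in> hom T (Dom C n) \<and> n \<cdot> h = u \<and> q' \<cdot> h = v"
      using terminal_unique[OF ter comp_in_hom[OF _ q'(1)] v] mono_cancel[OF n]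
      by (intro ex1I[of _ h]) auto
  qed
  then show ?thesis using cl n pb c c' unfolding is_subobject_classifier_def monos_into_def by blast
qed

text \<open>A topos is balanced. The characteristic arrow of \<open>m\<close> and the constant arrow
  true agree after \<open>m\<close>; if \<open>m\<close> is epic they are equal, so the identity
  belongs to \<open>m\<close>.\<close>

lemma epic_mono_top:
  assumes m: "m \<in> monos_into C X" and ep: "epic C m"
  shows "Id C X \<preceq> m"
proof -
  obtain Om t where cl: "is_subobject_classifier C Om t" using ex_subobject_classifier by blast
  have mh: "m \<in> hom (Dom C m) X" using monos_into_hom[OF m] .
  have X: "X \<in> Ob C" using homD(5)[OF mh] .
  obtain c where c: "c \<in> hom X Om" and fac: "\<forall>Z. \<forall>z\<in>hom Z X. c \<cdot> z \<preceq> t \<longleftrightarrow> z \<preceq> m"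
    using classifying_arrow[OF cl m] by blast
  have ter: "terminal C (Dom C t)" and t: "t \<in> hom (Dom C t) Om"
    using cl by (simp_all add: is_subobject_classifier_def)
  obtain b where b: "b \<in> hom X (Dom C t)" using terminal_arrow[OF ter X] by blast
  obtain h where h: "h \<in> hom (Dom C m) (Dom C t)" "t \<cdot> h = c \<cdot> m"
    using bspec[OF spec[OF fac] mh] factors_refl[OF mh] factorsE[OF _ comp_in_hom[OF mh c], of t]
      by blast
  have "h = b \<cdot> m" using terminal_unique[OF ter h(1) comp_in_hom[OF mh b]] .
  then have "c \<cdot> m = (t \<cdot> b) \<cdot> m" using h comp_assoc[OF mh b t] by simp
  then have "c = t \<cdot> b"
    using ep c comp_in_hom[OF b t] homD(3)[OF mh] homD(5)[OF t] unfolding epic_def by blast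
  then have "c \<cdot> Id C X = t \<cdot> b" using comp_id_right[OF c] by simp
  then have "c \<cdot> Id C X \<preceq> t"
    using factors_homI[OF comp_in_hom[OF id_in_hom[OF X] c] b] by simp
  then show ?thesis using bspec[OF spec[OF fac] id_in_hom[OF X]] by simp
qed

text \<open>
  The subobject \<open>\<forall>\<^sub>f u\<close> is the equalizer of the two arrows \<open>Y \<rightarrow> \<Omega>\<^bsup>X\<^esup>\<close> that send \<open>y\<close> to
  \<open>{a. f a = y}\<close> and to \<open>{a \<in> u. f a = y}\<close>; in the proof \<open>\<gamma>\<close> is the graph of \<open>f\<close>.
\<close>

lemma ex_forall_along:
  assumes f: "f \<in> hom X Y" and u: "u \<in> monos_into C X"
  shows "\<exists>w\<in>monos_into C Y. \<forall>V. \<forall>v\<in>hom V Y. v \<preceq> w \<longleftrightarrow>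
    (\<forall>Z. \<forall>a\<in>hom Z X. \<forall>b\<in>hom Z V. f \<cdot> a = v \<cdot> b \<longrightarrow> a \<preceq> u)"
proof -
  note X = homD(4)[OF f] and Y = homD(5)[OF f] and uh = monos_into_hom[OF u]
  obtain Om t where cl: "is_subobject_classifier C Om t" using ex_subobject_classifier by blast
  have Om: "Om \<in> Ob C" using homD(5)[OF monos_into_hom[OF truth_mono[OF cl]]] .
  obtain E P p q ev where E: "is_exponential C X Om E P p q ev"
    using ex_exponential[OF X Om] by blast
  then have P: "is_product C E X P p q" and ev: "ev \<in> hom P Om"
    by (simp_all add: is_exponential_def)
  have p: "p \<in> hom P E" and q: "q \<in> hom P X" using P by (simp_all add: is_product_def)
  have tr: "\<exists>!g. g \<in> hom Z E \<and> (\<exists>k\<in>hom Q P. p \<cdot> k = g \<cdot> r \<and> q \<cdot> k = s \<and> ev \<cdot> k = c)"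
    if "is_product C Z X Q r s" "c \<in> hom Q Om" for Z Q r s c
    using E that unfolding is_exponential_def by blast
  obtain Q r s where Q: "is_product C Y X Q r s" using ex_product[OF Y X] by blast
  have r: "r \<in> hom Q Y" and s: "s \<in> hom Q X" using Q by (simp_all add: is_product_def)
  obtain \<gamma> where \<gamma>: "\<gamma> \<in> hom X Q" "r \<cdot> \<gamma> = f" "s \<cdot> \<gamma> = Id C X"
    using productE[OF Q f id_in_hom[OF X]] by blast
  have \<gamma>m: "\<gamma> \<in> monos_into C Q"
    using split_monos_into[OF \<gamma>(1) s \<gamma>(3)] .
  have \<gamma>um: "\<gamma> \<cdot> u \<in> monos_into C Q"
    using comp_monos_into[OF \<gamma>m] u homD(2)[OF \<gamma>(1)] by simp
  note \<gamma>u = comp_in_hom[OF uh \<gamma>(1)]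
  \<comment> \<open>On \<open>Q\<close>, which is \<open>Y \<times> X\<close>, the arrow
    \<open>c1\<close> classifies the graph and \<open>c2\<close> its part over \<open>u\<close>.
    Their transposes are \<open>g1\<close> and \<open>g2\<close>.\<close>
  obtain c1 where c1: "c1 \<in> hom Q Om" and c1_iff: "\<forall>Z. \<forall>z\<in>hom Z Q. c1 \<cdot> z \<preceq> t \<longleftrightarrow> z \<preceq> \<gamma>"
    using classifying_arrow[OF cl \<gamma>m] by blast
  obtain c2 where c2: "c2 \<in> hom Q Om" and c2_iff: "\<forall>Z. \<forall>z\<in>hom Z Q. c2 \<cdot> z \<preceq> t \<longleftrightarrow> z \<preceq> \<gamma> \<cdot> u"
    using classifying_arrow[OF cl \<gamma>um] by blast
  obtain g1 k1 where g1: "g1 \<in> hom Y E" and k1: "k1 \<in> hom Q P" "p \<cdot> k1 = g1 \<cdot> r" "q \<cdot> k1 = s" "ev \<cdot> k1 = c1"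
    using tr[OF Q c1] by blast
  obtain g2 k2 where g2: "g2 \<in> hom Y E" and k2: "k2 \<in> hom Q P" "p \<cdot> k2 = g2 \<cdot> r" "q \<cdot> k2 = s" "ev \<cdot> k2 = c2"
    using tr[OF Q c2] by blast
  obtain w where w: "is_equalizer C g1 g2 w" using ex_equalizer[OF g1 g2] by blast
  have graph: "z \<preceq> \<gamma> \<longleftrightarrow> f \<cdot> (s \<cdot> z) = r \<cdot> z" if z: "z \<in> hom Z Q" for Z z
  proof
    assume "z \<preceq> \<gamma>"
    then obtain h where h: "h \<in> hom Z X" "\<gamma> \<cdot> h = z"
      using factorsE[OF _ z] homD(2)[OF \<gamma>(1)] by metis
    have "s \<cdot> z = h" "r \<cdot> z = f \<cdot> h"
      using h comp_assoc[OF h(1) \<gamma>(1) s] comp_assoc[OF h(1) \<gamma>(1) r] \<gamma> comp_id_left[OF h(1)]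
        by simp_all
    then show "f \<cdot> (s \<cdot> z) = r \<cdot> z" by simp
  next
    assume eq: "f \<cdot> (s \<cdot> z) = r \<cdot> z"
    note sz = comp_in_hom[OF z s]
    have "\<gamma> \<cdot> (s \<cdot> z) = z"
      by (rule product_eqI[OF Q comp_in_hom[OF sz \<gamma>(1)] z])
        (use eq comp_assoc[OF sz \<gamma>(1) s] comp_assoc[OF sz \<gamma>(1) r] \<gamma> comp_id_left[OF sz] in simp_all)
    then show "z \<preceq> \<gamma>"
      using factorsI[of "s \<cdot> z" z \<gamma>] sz homD(2)[OF z] homD(2)[OF \<gamma>(1)] by simp
  qed
  have graph_u: "z \<preceq> \<gamma> \<cdot> u \<longleftrightarrow> z \<preceq> \<gamma> \<and> s \<cdot> z \<preceq> u" if z: "z \<in> hom Z Q" for Z z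
  proof
    assume "z \<preceq> \<gamma> \<cdot> u"
    then obtain h where h: "h \<in> hom Z (Dom C u)" "(\<gamma> \<cdot> u) \<cdot> h = z"
      using factorsE[OF _ z] homD(2)[OF \<gamma>u] by metis
    note uh' = comp_in_hom[OF h(1) uh]
    have z': "\<gamma> \<cdot> (u \<cdot> h) = z" using h comp_assoc[OF h(1) uh \<gamma>(1)] by simp
    then have "s \<cdot> z = u \<cdot> h"
      using comp_assoc[OF uh' \<gamma>(1) s] \<gamma> comp_id_left[OF uh'] by simp
    then show "z \<preceq> \<gamma> \<and> s \<cdot> z \<preceq> u"
      using factors_homI[OF z _ z'] factors_homI[OF comp_in_hom[OF z s] h(1)] uh' homD(2)[OF \<gamma>(1)]
      by simp
  next
    assume "z \<preceq> \<gamma> \<and> s \<cdot> z \<preceq> u"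
    then obtain h k where h: "h \<in> hom Z X" "\<gamma> \<cdot> h = z" and k: "k \<in> hom Z (Dom C u)" "u \<cdot> k = s \<cdot> z"
      using factorsE[OF _ z] factorsE[OF _ comp_in_hom[OF z s]] homD(2)[OF \<gamma>(1)] by metis
    have "s \<cdot> z = h"
      using h comp_assoc[OF h(1) \<gamma>(1) s] \<gamma> comp_id_left[OF h(1)] by simp
    then have "(\<gamma> \<cdot> u) \<cdot> k = z"
      using k h comp_assoc[OF k(1) uh \<gamma>(1)] by simp
    then show "z \<preceq> \<gamma> \<cdot> u"
      using factorsI[of k z "\<gamma> \<cdot> u"] k homD(2)[OF z] homD(2)[OF \<gamma>u] by simp
  qed
  show ?thesis
  proof (intro bexI allI ballI)
    show "w \<in> monos_into C Y" using equalizer_monos_into(1)[OF w g1 g2] .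
    fix V v assume v: "v \<in> hom V Y"
    obtain R r' s' where R: "is_product C V X R r' s'" using ex_product[OF homD(4)[OF v] X] by blast
    have r': "r' \<in> hom R V" and s': "s' \<in> hom R X" using R by (simp_all add: is_product_def)
    note vr' = comp_in_hom[OF r' v]
    \<comment> \<open>\<open>R\<close> is \<open>V \<times> X\<close>, and \<open>d\<close> is the
      product of \<open>v\<close> with the identity of \<open>X\<close>.\<close>
    obtain d where d: "d \<in> hom R Q" "r \<cdot> d = v \<cdot> r'" "s \<cdot> d = s'"
      using productE[OF Q vr' s'] by blast
    \<comment> \<open>Transposition is natural: if \<open>g\<close> is the transpose of
      \<open>c\<close>, then \<open>g \<cdot> v\<close> is the transpose of
      \<open>c \<cdot> d\<close>.\<close>
    have transpose: "p \<cdot> (k \<cdot> d) = (g \<cdot> v) \<cdot> r'" "q \<cdot> (k \<cdot> d) = s'" "ev \<cdot> (k \<cdot> d) = c \<cdot> d"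
      if "g \<in> hom Y E" "k \<in> hom Q P" "p \<cdot> k = g \<cdot> r" "q \<cdot> k = s" "ev \<cdot> k = c" for g k c
      using that d comp_assoc[OF d(1) that(2) p] comp_assoc[OF d(1) that(2) q]
        comp_assoc[OF d(1) that(2) ev] comp_assoc[OF d(1) r that(1)] comp_assoc[OF r' v that(1)]
      by simp_all
    note t1 = transpose[OF g1 k1] and t2 = transpose[OF g2 k2]
    note d1 = comp_in_hom[OF d(1) k1(1)] and d2 = comp_in_hom[OF d(1) k2(1)]
    \<comment> \<open>The chain passes from transposes to characteristic arrows on
      \<open>V \<times> X\<close>, then to the elements they make true. The final condition says
      that the pullback of \<open>v\<close> along \<open>f\<close> lies in \<open>u\<close>, which
      is the adjunction for \<forall> along \<open>f\<close>.\<close>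
    have "v \<preceq> w \<longleftrightarrow> g1 \<cdot> v = g2 \<cdot> v"
      using equalizer_monos_into(2)[OF w g1 g2 v] .
    also have "\<dots> \<longleftrightarrow> c1 \<cdot> d = c2 \<cdot> d"
    proof
      assume "g1 \<cdot> v = g2 \<cdot> v"
      then have "k1 \<cdot> d = k2 \<cdot> d" using product_eqI[OF P d1 d2] t1 t2 by simp
      then show "c1 \<cdot> d = c2 \<cdot> d" using t1 t2 by simp
    next
      assume "c1 \<cdot> d = c2 \<cdot> d"
      then show "g1 \<cdot> v = g2 \<cdot> v"
        using tr[OF R comp_in_hom[OF d(1) c1]] t1 t2 d1 d2 comp_in_hom[OF v g1] comp_in_hom[OF v g2]
        by metis
    qed
    also have "\<dots> \<longleftrightarrow> (\<forall>Z. \<forall>z\<in>hom Z R. d \<cdot> z \<preceq> \<gamma> \<longleftrightarrow> d \<cdot> z \<preceq> \<gamma> \<cdot> u)"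
    proof -
      have iff: "c1 \<cdot> d \<cdot> z \<preceq> t \<longleftrightarrow> d \<cdot> z \<preceq> \<gamma>" "c2 \<cdot> d \<cdot> z \<preceq> t \<longleftrightarrow> d \<cdot> z \<preceq> \<gamma> \<cdot> u"
        if z: "z \<in> hom Z R" for Z z
        using c1_iff c2_iff comp_in_hom[OF z d(1)] comp_assoc[OF z d(1) c1] comp_assoc[OF z d(1) c2]
        by metis+
      show ?thesis
        using classifier_eqI[OF cl comp_in_hom[OF d(1) c1] comp_in_hom[OF d(1) c2]] iff by metis
    qed
    also have "\<dots> \<longleftrightarrow> (\<forall>Z. \<forall>z\<in>hom Z R. f \<cdot> (s' \<cdot> z) = v \<cdot> (r' \<cdot> z) \<longrightarrow> s' \<cdot> z \<preceq> u)"
    proof -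
      have "(d \<cdot> z \<preceq> \<gamma> \<longleftrightarrow> d \<cdot> z \<preceq> \<gamma> \<cdot> u) \<longleftrightarrow> (f \<cdot> (s' \<cdot> z) = v \<cdot> (r' \<cdot> z) \<longrightarrow> s' \<cdot> z \<preceq> u)"
        if z: "z \<in> hom Z R" for Z z
      proof -
        note dz = comp_in_hom[OF z d(1)]
        have "s \<cdot> (d \<cdot> z) = s' \<cdot> z" "r \<cdot> (d \<cdot> z) = v \<cdot> (r' \<cdot> z)"
          using d comp_assoc[OF z d(1) s] comp_assoc[OF z d(1) r] comp_assoc[OF z r' v] by simp_all
        then show ?thesis using graph[OF dz] graph_u[OF dz] by auto
      qed
      then show ?thesis by blast
    qed
    \<comment> \<open>A pair \<open>b\<close>, \<open>a\<close> with common domain is the same as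
      one arrow \<open>z\<close> into the product \<open>R\<close>.\<close>
    also have "\<dots> \<longleftrightarrow> (\<forall>Z. \<forall>a\<in>hom Z X. \<forall>b\<in>hom Z V. f \<cdot> a = v \<cdot> b \<longrightarrow> a \<preceq> u)"
      using productE[OF R] comp_in_hom[OF _ r'] comp_in_hom[OF _ s'] by metis
    finally show "v \<preceq> w \<longleftrightarrow> (\<forall>Z. \<forall>a\<in>hom Z X. \<forall>b\<in>hom Z V. f \<cdot> a = v \<cdot> b \<longrightarrow> a \<preceq> u)" .
  qed
qed

text \<open>Both \<open>s\<close> and \<open>t\<close> lie in the universal quantification
  \<open>w\<close> of \<open>u\<close> along \<open>f\<close>, so \<open>w\<close> is all of
  \<open>Y\<close>, and by adjunction \<open>u\<close> is all of \<open>X\<close>. This serves as a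
  case distinction: a claim on \<open>X\<close> may be checked on the elements that \<open>f\<close>
  sends into \<open>s\<close> and on those it sends into \<open>t\<close>.\<close>

lemma covers_pullback:
  assumes cov: "covers Y s t" and s: "s \<in> monos_into C Y" and t: "t \<in> monos_into C Y"
    and f: "f \<in> hom X Y" and u: "u \<in> monos_into C X"
    and us: "\<And>Z a b. a \<in> hom Z X \<Longrightarrow> b \<in> hom Z (Dom C s) \<Longrightarrow> f \<cdot> a = s \<cdot> b \<Longrightarrow> a \<preceq> u"
    and ut: "\<And>Z a b. a \<in> hom Z X \<Longrightarrow> b \<in> hom Z (Dom C t) \<Longrightarrow> f \<cdot> a = t \<cdot> b \<Longrightarrow> a \<preceq> u"
  shows "Id C X \<preceq> u"
proof -
  obtain w where w: "w \<in> monos_into C Y" and w_iff: "\<forall>V. \<forall>v\<in>hom V Y. v \<preceq> w \<longleftrightarrow>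
      (\<forall>Z. \<forall>a\<in>hom Z X. \<forall>b\<in>hom Z V. f \<cdot> a = v \<cdot> b \<longrightarrow> a \<preceq> u)"
    using ex_forall_along[OF f u] by blast
  have "s \<preceq> w" "t \<preceq> w"
    using w_iff monos_into_hom[OF s] monos_into_hom[OF t] us ut by blast+
  then have "Id C Y \<preceq> w" using cov w by (simp add: covers_def)
  \<comment> \<open>The defining property of \<open>w\<close> is used at the identity of
    \<open>Y\<close>, with \<open>a\<close> the identity of \<open>X\<close> and \<open>b\<close>
    equal to \<open>f\<close>.\<close>
  then show ?thesis
    using w_iff id_in_hom[OF homD(5)[OF f]] id_in_hom[OF homD(4)[OF f]] f comp_id_left[OF f] comp_id_right[OF f]
    by metis
qed

text \<open>A common element of \<open>s'\<close> and \<open>t'\<close> is mapped by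
  \<open>f\<close> to a common element of \<open>s\<close> and \<open>t\<close>, which gives
  disjointness; the covering part is \<open>covers_pullback\<close>.\<close>

lemma complementary_pullback:
  assumes c: "complementary Y s t" and f: "f \<in> hom X Y"
    and s': "is_pullback C f s s' a" and t': "is_pullback C f t t' b"
  shows "complementary X s' t'"
proof -
  have s: "s \<in> monos_into C Y" and t: "t \<in> monos_into C Y" and dis: "disjoint s t" and cov: "covers Y s t"
    using c by (auto simp: complementary_def)
  note sm = pullback_mono[OF s' f s] and tm = pullback_mono[OF t' f t]
  note sD = pullbackD[OF s' f monos_into_hom[OF s]] and tD = pullbackD[OF t' f monos_into_hom[OF t]]
  have "disjoint s' t'"
    unfolding disjoint_def
  proof (intro allI ballI impI)
    fix T u v assume u: "u \<in> hom T (Dom C s')" and v: "v \<in> hom T (Dom C t')" and eq: "s' \<cdot> u = t' \<cdot> v"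
    have "s \<cdot> (a \<cdot> u) = f \<cdot> (s' \<cdot> u)"
      using comp_assoc[OF u sD(2) monos_into_hom[OF s]] comp_assoc[OF u sD(1) f] sD(3) by simp
    also have "\<dots> = t \<cdot> (b \<cdot> v)"
      using eq comp_assoc[OF v tD(2) monos_into_hom[OF t]] comp_assoc[OF v tD(1) f] tD(3) by simp
    finally show "initial C T"
      using disjointD[OF dis comp_in_hom[OF u sD(2)] comp_in_hom[OF v tD(2)]] by simp
  qed
  moreover have "covers X s' t'"
    unfolding covers_def
  proof (intro ballI impI)
    fix w assume w: "w \<in> monos_into C X" and sw: "s' \<preceq> w" and tw: "t' \<preceq> w"
    have le: "z \<preceq> w" if z: "z \<in> hom Z X" and k: "k \<in> hom Z (Dom C n)" "f \<cdot> z = n \<cdot> k"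
      and n': "n' \<in> monos_into C X" "n' \<preceq> w" and n: "\<And>T z. z \<in> hom T X \<Longrightarrow> z \<preceq> n' \<longleftrightarrow> f \<cdot> z \<preceq> n"
      for Z z k n n'
    proof -
      have "f \<cdot> z \<preceq> n"
        using factors_homI[OF comp_in_hom[OF z f] k(1) k(2)[symmetric]] .
      then show ?thesis
        using n[OF z] factors_trans[OF _ n'(2) z monos_into_hom[OF n'(1)] monos_into_hom[OF w]]
          by blast
    qed
    show "Id C X \<preceq> w"
      by (rule covers_pullback[OF cov s t f w])
        (erule (2) le[OF _ _ _ sm(1) sw sm(2)], assumption, erule (2) le[OF _ _ _ tm(1) tw tm(2)], assumption)
  qed
  ultimately show ?thesis using sm(1) tm(1) by (simp add: complementary_def)
qed

section \<open>Complements in the poset of subobjects\<close>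

lemma is_complement_iff:
  assumes s: "s \<in> monos_into C X" and t: "t \<in> monos_into C X"
  shows "is_complement C X (sub_class X s) (sub_class X t) \<longleftrightarrow> complementary X s t"
proof
  note sh = monos_into_hom[OF s] and th = monos_into_hom[OF t]
  note X = homD(5)[OF sh] and le = le_Sub_iff and car = sub_class_in_carrier
  \<comment> \<open>The bottom subobject is the arrow \<open>z\<close> from an initial object, monic
    by strictness; the top is the identity.\<close>
  obtain O0 where O0: "initial C O0" using ex_initial by blast
  obtain z where zh: "z \<in> hom O0 X" using initial_arrow[OF O0 X] by blast
  note z = initial_mono[OF O0 zh] and I = Id_monos_into[OF X]
  have z_le: "z \<preceq> w" if w: "w \<in> monos_into C X" for w
  proof -
    obtain h where h: "h \<in> hom O0 (Dom C w)"
      using initial_arrow[OF O0 homD(4)[OF monos_into_hom[OF w]]] by blast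
    then show ?thesis
      using factorsI[of h z w] initial_unique[OF O0 comp_in_hom[OF h monos_into_hom[OF w]] zh] homD(2)[OF zh]
        by simp
  qed
  have le_I: "w \<preceq> Id C X" if w: "w \<in> monos_into C X" for w
    using factorsI[of w w "Id C X"] monos_into_hom[OF w] comp_id_left[OF monos_into_hom[OF w]] X
      by simp
  {
    assume "is_complement C X (sub_class X s) (sub_class X t)"
    then obtain b e where
      b: "least (Sub C X) b (carrier (Sub C X))"
        "greatest (Sub C X) b (Lower (Sub C X) {sub_class X s, sub_class X t})"
      and e: "greatest (Sub C X) e (carrier (Sub C X))"
        "least (Sub C X) e (Upper (Sub C X) {sub_class X s, sub_class X t})"
      unfolding is_complement_def by blast
    obtain b' where b': "b' \<in> monos_into C X" "b = sub_class X b'"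
      using carrier_SubE b(1) unfolding least_def by blast
    obtain e' where e': "e' \<in> monos_into C X" "e = sub_class X e'"
      using carrier_SubE e(1) unfolding greatest_def by blast
    have bz: "b' \<preceq> z" using b(1) car[OF z] le[OF b'(1) z] b'(2) by (auto simp: least_def)
    have Ie: "Id C X \<preceq> e'"
      using e(1) car[OF I] le[OF I e'(1)] e'(2) by (auto simp: greatest_def)
    have lower: "w \<preceq> b'" if w: "w \<in> monos_into C X" "w \<preceq> s" "w \<preceq> t" for w
    proof -
      have "sub_class X w \<in> Lower (Sub C X) {sub_class X s, sub_class X t}"
        using w s t by (auto simp: Lower_def le car)
      then show ?thesis using b(2) le[OF w(1) b'(1)] b'(2) by (auto simp: greatest_def)
    qed
    have upper: "e' \<preceq> w" if w: "w \<in> monos_into C X" "s \<preceq> w" "t \<preceq> w" for w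
    proof -
      have "sub_class X w \<in> Upper (Sub C X) {sub_class X s, sub_class X t}"
        using w s t by (auto simp: Upper_def le car)
      then show ?thesis using e(2) le[OF e'(1) w(1)] e'(2) by (auto simp: least_def)
    qed
    \<comment> \<open>The composite \<open>s \<cdot> n\<close> is the intersection of
      \<open>s\<close> and \<open>t\<close>. It lies below the bottom, so its domain has an arrow to
      \<open>O0\<close>, and strictness makes the domain of every common element initial.\<close>
    obtain n q where pb: "is_pullback C s t n q" using ex_pullback[OF sh th] by blast
    note nm = pullback_mono(1)[OF pb sh t] and nD = pullbackD[OF pb sh th]
    note sn = comp_monos_into[OF s nm] and snh = comp_in_hom[OF nD(1) sh]
    have "s \<cdot> n \<preceq> s" using factors_homI[OF snh nD(1)] by simp
    moreover have "s \<cdot> n \<preceq> t" using factors_homI[OF snh nD(2) nD(3)[symmetric]] .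
    ultimately have "s \<cdot> n \<preceq> z"
      using factors_trans[OF lower[OF sn] bz snh monos_into_hom[OF b'(1)] zh] by blast
    then obtain h where h: "h \<in> hom (Dom C n) O0"
      using factorsE[OF _ snh] homD(2)[OF zh] by metis
    have "disjoint s t"
      unfolding disjoint_def
    proof (intro allI ballI impI)
      fix T u v assume uv: "u \<in> hom T (Dom C s)" "v \<in> hom T (Dom C t)" "s \<cdot> u = t \<cdot> v"
      then obtain k where "k \<in> hom T (Dom C n)" using pullback_ex1[OF pb sh th uv] by blast
      then show "initial C T" using strict_initial[OF O0 comp_in_hom[OF _ h]] by blast
    qed
    moreover have "covers X s t"
      unfolding covers_def
      using factors_trans[OF Ie upper id_in_hom[OF X] monos_into_hom[OF e'(1)] monos_into_hom]
        by blast
    ultimately show "complementary X s t" using s t by (simp add: complementary_def)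
  next
    assume "complementary X s t"
    then have dis: "disjoint s t" and cov: "covers X s t" by (auto simp: complementary_def)
    have zw: "w \<preceq> z" if w: "w \<in> monos_into C X" "w \<preceq> s" "w \<preceq> t" for w
    proof -
      note wh = monos_into_hom[OF w(1)]
      obtain u v where "u \<in> hom (Dom C w) (Dom C s)" "s \<cdot> u = w" "v \<in> hom (Dom C w) (Dom C t)" "t \<cdot> v = w"
        using factorsE[OF w(2) wh] factorsE[OF w(3) wh] by metis
      then have i: "initial C (Dom C w)" using disjointD[OF dis] by metis
      obtain h where h: "h \<in> hom (Dom C w) O0" using initial_arrow[OF i homD(4)[OF zh]] by blast
      then show ?thesis
        using factorsI[of h w z] initial_unique[OF i comp_in_hom[OF h zh] wh] homD(2)[OF zh] by simp
    qed
    have "least (Sub C X) (sub_class X z) (carrier (Sub C X))"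
      using z z_le by (auto simp: least_def le car elim!: carrier_SubE)
    moreover have "greatest (Sub C X) (sub_class X z) (Lower (Sub C X) {sub_class X s, sub_class X t})"
      using z z_le s t zw by (auto simp: greatest_def Lower_def le car elim!: carrier_SubE)
    moreover have "greatest (Sub C X) (sub_class X (Id C X)) (carrier (Sub C X))"
      using I le_I by (auto simp: greatest_def le car elim!: carrier_SubE)
    moreover have "least (Sub C X) (sub_class X (Id C X)) (Upper (Sub C X) {sub_class X s, sub_class X t})"
      using I le_I s t cov by (auto simp: least_def Upper_def le car covers_def elim!: carrier_SubE)
    ultimately show "is_complement C X (sub_class X s) (sub_class X t)"
      using car s t unfolding is_complement_def by blast
  }
qed

lemma Sub_c_iff:
  assumes s: "s \<in> monos_into C X"
  shows "sub_class X s \<in> Sub_c C X \<longleftrightarrow> (\<exists>t. complementary X s t)"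
proof
  assume "sub_class X s \<in> Sub_c C X"
  then obtain T where T: "is_complement C X (sub_class X s) T" by (auto simp: Sub_c_def)
  then obtain t where "t \<in> monos_into C X" "T = sub_class X t"
    using carrier_SubE unfolding is_complement_def by blast
  then show "\<exists>t. complementary X s t" using T is_complement_iff[OF s] by blast
next
  assume "\<exists>t. complementary X s t"
  then obtain t where "complementary X s t" by blast
  then show "sub_class X s \<in> Sub_c C X"
    using is_complement_iff[OF s, of t] sub_class_in_carrier[OF s]
    by (auto simp: Sub_c_def complementary_def)
qed

section \<open>Arrows to 2\<close>

text \<open>The arrow \<open>b\<close> classifies the initial subobject of \<open>I\<close>; for
  terminal \<open>I\<close> it is false. An element it makes true maps to an initial object, so
  strictness applies.\<close>

lemma ex_false:
  assumes cl: "is_subobject_classifier C Om t" and I: "I \<in> Ob C"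
  shows "\<exists>b\<in>hom I Om. \<forall>T. \<forall>z\<in>hom T I. b \<cdot> z \<preceq> t \<longrightarrow> initial C T"
proof -
  obtain Z where Z: "initial C Z" using ex_initial by blast
  obtain o' where o': "o' \<in> hom Z I" using initial_arrow[OF Z I] by blast
  obtain b where b: "b \<in> hom I Om" and iff: "\<forall>T. \<forall>z\<in>hom T I. b \<cdot> z \<preceq> t \<longleftrightarrow> z \<preceq> o'"
    using classifying_arrow[OF cl initial_mono[OF Z o']] by blast
  have "initial C T" if z: "z \<in> hom T I" and "b \<cdot> z \<preceq> t" for T z
  proof -
    have "z \<preceq> o'" using that iff by blast
    then obtain h where "h \<in> hom T Z" using factorsE[OF _ z] homD(2)[OF o'] by metis
    then show ?thesis using strict_initial[OF Z] by blast
  qed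
  then show ?thesis using b by blast
qed

text \<open>Half of the injectivity of \<open>h\<close>. Where \<open>y\<close> lies in
  \<open>k\<close>, it equals \<open>k \<cdot> b\<close> because arrows into \<open>I\<close> are
  unique; the part where \<open>y\<close> lies in \<open>k'\<close> is initial by
  \<open>sep\<close>. So the equalizer of \<open>y\<close> and \<open>k \<cdot> b\<close> is
  everything.\<close>

lemma cover_separated:
  assumes I: "terminal C I" and k: "k \<in> hom I B" and k': "k' \<in> hom I B" and cov: "covers B k k'"
    and h: "h \<in> hom B Y"
    and sep: "\<And>T z z'. z \<in> hom T I \<Longrightarrow> z' \<in> hom T I \<Longrightarrow> h \<cdot> (k \<cdot> z) = h \<cdot> (k' \<cdot> z') \<Longrightarrow> initial C T"
    and y: "y \<in> hom T B" and b: "b \<in> hom T I" and eq: "h \<cdot> y = h \<cdot> (k \<cdot> b)"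
  shows "y = k \<cdot> b"
proof -
  note kb = comp_in_hom[OF b k] and T = homD(4)[OF y]
  obtain e where e: "is_equalizer C y (k \<cdot> b) e" using ex_equalizer[OF y kb] by blast
  note em = equalizer_monos_into[OF e y kb]
  have "Id C T \<preceq> e"
  proof (rule covers_pullback[OF cov terminal_mono[OF I k] terminal_mono[OF I k'] y em(1)])
    fix Z a c assume a: "a \<in> hom Z T" and c: "c \<in> hom Z (Dom C k)" and ac: "y \<cdot> a = k \<cdot> c"
    have "c = b \<cdot> a" using terminal_unique[OF I _ comp_in_hom[OF a b]] c homD(2)[OF k] by simp
    then show "a \<preceq> e" using em(2)[OF a] ac comp_assoc[OF a b k] by simp
  next
    fix Z a c assume a: "a \<in> hom Z T" and c': "c \<in> hom Z (Dom C k')" and ac: "y \<cdot> a = k' \<cdot> c"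
    have c: "c \<in> hom Z I" using c' homD(2)[OF k'] by simp
    have "h \<cdot> (k \<cdot> (b \<cdot> a)) = (h \<cdot> (k \<cdot> b)) \<cdot> a"
      using comp_assoc[OF a b k] comp_assoc[OF a kb h] by simp
    also have "\<dots> = h \<cdot> (k' \<cdot> c)" using comp_assoc[OF a y h] ac eq by simp
    finally have "initial C Z" using sep[OF comp_in_hom[OF a b] c] by simp
    then show "a \<preceq> e" using initial_factors[OF _ a monos_into_hom[OF em(1)]] by simp
  qed
  then have "y \<cdot> Id C T = (k \<cdot> b) \<cdot> Id C T"
    using em(2)[OF id_in_hom[OF T]] by simp
  then show ?thesis using comp_id_right[OF y] comp_id_right[OF kb] by simp
qed

text \<open>The arrow \<open>h\<close> is \<open>[true, false]\<close>.\<close>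

lemma two_into_classifier:
  assumes cl: "is_subobject_classifier C Om t" and I: "terminal C I" and B: "is_coproduct C I I B i j"
  shows "\<exists>h\<in>monos_into C Om. Dom C h = B \<and> h \<cdot> i \<preceq> t \<and>
    (\<forall>T. \<forall>z\<in>hom T I. h \<cdot> (j \<cdot> z) \<preceq> t \<longrightarrow> initial C T)"
proof -
  have i: "i \<in> hom I B" and j: "j \<in> hom I B" using B by (simp_all add: is_coproduct_def)
  note IO = homD(4)[OF i] and t = monos_into_hom[OF truth_mono[OF cl]]
  obtain b where b: "b \<in> hom I Om" and b0: "\<forall>T. \<forall>z\<in>hom T I. b \<cdot> z \<preceq> t \<longrightarrow> initial C T"
    using ex_false[OF cl IO] by blast
  obtain e where e: "e \<in> hom I (Dom C t)"
    using cl terminal_arrow[OF _ IO] unfolding is_subobject_classifier_def by blast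
  note te = comp_in_hom[OF e t]
  obtain h where h: "h \<in> hom B Om" "h \<cdot> i = t \<cdot> e" "h \<cdot> j = b"
    using B te b homD(5)[OF b] unfolding is_coproduct_def by blast
  have hi: "h \<cdot> i \<preceq> t" using h factors_homI[OF te e] by simp
  have hj: "initial C T" if z: "z \<in> hom T I" "h \<cdot> (j \<cdot> z) \<preceq> t" for T z
    using z b0 unfolding comp_assoc[OF z(1) j h(1)] h(3) by blast
  have sep: "initial C T" if z: "z \<in> hom T I" "z' \<in> hom T I" "h \<cdot> (i \<cdot> z) = h \<cdot> (j \<cdot> z')" for T z z'
  proof -
    have "h \<cdot> (i \<cdot> z) \<preceq> t"
      using factors_comp[OF hi comp_in_hom[OF i h(1)] t z(1)] comp_assoc[OF z(1) i h(1)] by simp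
    then show ?thesis using hj[OF z(2)] z(3) by simp
  qed
  note cov = coproduct_covers[OF B]
  have "h \<in> monos_into C Om"
  proof (rule monicI[OF h(1)])
    fix T u v assume u: "u \<in> hom T B" and v: "v \<in> hom T B" and uv: "h \<cdot> u = h \<cdot> v"
    note T = homD(4)[OF u]
    obtain e where e: "is_equalizer C u v e" using ex_equalizer[OF u v] by blast
    note em = equalizer_monos_into[OF e u v]
    have hv: "h \<cdot> (v \<cdot> a) = h \<cdot> (k \<cdot> c)" if "a \<in> hom Z T" "u \<cdot> a = k \<cdot> c" for Z a k c
      using comp_assoc[OF that(1) u h(1)] comp_assoc[OF that(1) v h(1)] uv that(2) by simp
    \<comment> \<open>The cases are whether \<open>u\<close> lies in \<open>i\<close> or in
      \<open>j\<close>; in each, \<open>cover_separated\<close> puts \<open>v\<close> at the same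
      point, once with the roles of \<open>i\<close> and \<open>j\<close> exchanged.\<close>
    have "Id C T \<preceq> e"
    proof (rule covers_pullback[OF cov terminal_mono[OF I i] terminal_mono[OF I j] u em(1)])
      fix Z a c assume a: "a \<in> hom Z T" and c: "c \<in> hom Z (Dom C i)" and ac: "u \<cdot> a = i \<cdot> c"
      have "v \<cdot> a = i \<cdot> c"
        by (rule cover_separated[OF I i j cov h(1) sep comp_in_hom[OF a v] _ hv[OF a ac]])
          (use c homD(2)[OF i] in simp_all)
      then show "a \<preceq> e" using em(2)[OF a] ac by simp
    next
      fix Z a c assume a: "a \<in> hom Z T" and c: "c \<in> hom Z (Dom C j)" and ac: "u \<cdot> a = j \<cdot> c"
      have "v \<cdot> a = j \<cdot> c"
        by (rule cover_separated[OF I j i covers_sym[OF cov] h(1) sep[OF _ _ sym] comp_in_hom[OF a v] _ hv[OF a ac]])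
          (use c homD(2)[OF j] in simp_all)
      then show "a \<preceq> e" using em(2)[OF a] ac by simp
    qed
    then have "u \<cdot> Id C T = v \<cdot> Id C T" using em(2)[OF id_in_hom[OF T]] by simp
    then show "u = v" using comp_id_right[OF u] comp_id_right[OF v] by simp
  qed
  then show ?thesis using homD(2)[OF h(1)] hi hj by blast
qed

text \<open>Under [true, false] a common element becomes true because it lies in \<open>i\<close>;
  lying in \<open>j\<close>, it can be true only if its domain is initial.\<close>

lemma two_disjoint:
  assumes I: "terminal C I" and B: "is_coproduct C I I B i j"
  shows "disjoint i j"
  unfolding disjoint_def
proof (intro allI ballI impI)
  have i: "i \<in> hom I B" and j: "j \<in> hom I B" using B by (simp_all add: is_coproduct_def)
  fix T u v assume "u \<in> hom T (Dom C i)" "v \<in> hom T (Dom C j)" and eq: "i \<cdot> u = j \<cdot> v"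
  then have u: "u \<in> hom T I" and v: "v \<in> hom T I"
    using homD(2)[OF i] homD(2)[OF j] by simp_all
  obtain Om t where cl: "is_subobject_classifier C Om t" using ex_subobject_classifier by blast
  obtain h where hm: "h \<in> monos_into C Om" and Dh: "Dom C h = B" and hi: "h \<cdot> i \<preceq> t"
    and hj: "\<forall>T. \<forall>z\<in>hom T I. h \<cdot> (j \<cdot> z) \<preceq> t \<longrightarrow> initial C T"
    using two_into_classifier[OF cl I B] by blast
  have h: "h \<in> hom B Om" using monos_into_hom[OF hm] Dh by simp
  have "h \<cdot> (i \<cdot> u) \<preceq> t"
    using factors_comp[OF hi comp_in_hom[OF i h] monos_into_hom[OF truth_mono[OF cl]] u]
      comp_assoc[OF u i h] by simp
  then show "initial C T" using hj v unfolding eq by blast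
qed

text \<open>The characteristic arrow \<open>x\<close> of \<open>s\<close> is true on
  \<open>s\<close> and false on \<open>s'\<close>. So on both pieces it factors through
  \<open>h\<close>, which is [true, false], and since the pieces cover \<open>X\<close> it does so
  globally.\<close>

lemma complementary_arrow_to_two:
  assumes c: "complementary X s s'" and I: "terminal C I" and B: "is_coproduct C I I B i j"
  shows "\<exists>f\<in>hom X B. \<exists>a\<in>hom (Dom C s) I. \<exists>b\<in>hom (Dom C s') I. f \<cdot> s = i \<cdot> a \<and> f \<cdot> s' = j \<cdot> b"
proof -
  have s: "s \<in> monos_into C X" and s': "s' \<in> monos_into C X"
    and dis: "disjoint s s'" and cov: "covers X s s'"
    using c by (auto simp: complementary_def)
  note sh = monos_into_hom[OF s] and sh' = monos_into_hom[OF s']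
  note X = homD(5)[OF sh]
  have i: "i \<in> hom I B" and j: "j \<in> hom I B" using B by (simp_all add: is_coproduct_def)
  obtain Om t where cl: "is_subobject_classifier C Om t" using ex_subobject_classifier by blast
  have ter: "terminal C (Dom C t)" using cl by (simp add: is_subobject_classifier_def)
  note t = monos_into_hom[OF truth_mono[OF cl]]
  obtain h where hm: "h \<in> monos_into C Om" and Dh: "Dom C h = B" and hi: "h \<cdot> i \<preceq> t"
    and hj: "\<forall>T. \<forall>z\<in>hom T I. h \<cdot> (j \<cdot> z) \<preceq> t \<longrightarrow> initial C T"
    using two_into_classifier[OF cl I B] by blast
  have h: "h \<in> hom B Om" using monos_into_hom[OF hm] Dh by simp
  obtain e where e: "e \<in> hom I (Dom C t)" "t \<cdot> e = h \<cdot> i"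
    using factorsE[OF hi comp_in_hom[OF i h]] by blast
  obtain x where x: "x \<in> hom X Om" and x_iff: "\<forall>Z. \<forall>z\<in>hom Z X. x \<cdot> z \<preceq> t \<longleftrightarrow> z \<preceq> s"
    using classifying_arrow[OF cl s] by blast
  obtain a where a: "a \<in> hom (Dom C s) I" using terminal_arrow[OF I homD(4)[OF sh]] by blast
  obtain b where b: "b \<in> hom (Dom C s') I" using terminal_arrow[OF I homD(4)[OF sh']] by blast
  note ia = comp_in_hom[OF a i] and jb = comp_in_hom[OF b j]
  have "x \<cdot> s \<preceq> t" using x_iff sh factors_refl[OF sh] by blast
  then obtain e' where e': "e' \<in> hom (Dom C s) (Dom C t)" "t \<cdot> e' = x \<cdot> s"
    using factorsE[OF _ comp_in_hom[OF sh x]] by blast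
  have "e' = e \<cdot> a" using terminal_unique[OF ter e'(1) comp_in_hom[OF a e(1)]] .
  then have xs: "h \<cdot> (i \<cdot> a) = x \<cdot> s"
    using e e' comp_assoc[OF a i h] comp_assoc[OF a e(1) t] by simp
  have xs': "h \<cdot> (j \<cdot> b) = x \<cdot> s'"
  \<comment> \<open>Either arrow makes \<open>z\<close> true only when its domain is initial: the
    left one because it is false, the right one because \<open>s\<close> and \<open>s'\<close> are
    disjoint. With initial domain both make it true.\<close>
  proof (rule classifier_eqI[OF cl comp_in_hom[OF jb h] comp_in_hom[OF sh' x]])
    fix Z z assume z: "z \<in> hom Z (Dom C s')"
    note bz = comp_in_hom[OF z b] and sz = comp_in_hom[OF z sh']
    have 1: "(h \<cdot> (j \<cdot> b)) \<cdot> z = h \<cdot> (j \<cdot> (b \<cdot> z))"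
      using comp_assoc[OF z jb h] comp_assoc[OF z b j] by simp
    have "initial C Z" if "(h \<cdot> (j \<cdot> b)) \<cdot> z \<preceq> t"
      using that hj bz unfolding 1 by blast
    moreover have "initial C Z" if "(x \<cdot> s') \<cdot> z \<preceq> t"
    proof -
      have "s' \<cdot> z \<preceq> s"
        using that x_iff sz unfolding comp_assoc[OF z sh' x, symmetric] by blast
      then obtain k where k: "k \<in> hom Z (Dom C s)" "s \<cdot> k = s' \<cdot> z"
        using factorsE[OF _ sz] by blast
      show ?thesis using disjointD[OF dis k(1) z k(2)] .
    qed
    ultimately show "(h \<cdot> (j \<cdot> b)) \<cdot> z \<preceq> t \<longleftrightarrow> (x \<cdot> s') \<cdot> z \<preceq> t"
      using initial_factors[OF _ comp_in_hom[OF z comp_in_hom[OF jb h]] t]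
        initial_factors[OF _ comp_in_hom[OF z comp_in_hom[OF sh' x]] t] by blast
  qed
  obtain w q where pb: "is_pullback C x h w q" using ex_pullback[OF x h] by blast
  note w = pullback_mono[OF pb x hm]
  have "s \<preceq> w" using w(2)[OF sh] factors_homI[OF comp_in_hom[OF sh x] _ xs] ia Dh by simp
  moreover have "s' \<preceq> w"
    using w(2)[OF sh'] factors_homI[OF comp_in_hom[OF sh' x] _ xs'] jb Dh by simp
  ultimately have "Id C X \<preceq> w" using cov w(1) by (simp add: covers_def)
  then have "x \<preceq> h" using w(2)[OF id_in_hom[OF X]] comp_id_right[OF x] by simp
  then obtain f where f: "f \<in> hom X B" "h \<cdot> f = x" using factorsE[OF _ x] Dh by metis
  have "f \<cdot> s = i \<cdot> a"
    by (rule mono_cancel[OF hm, of _ "Dom C s"])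
      (use comp_in_hom[OF sh f(1)] ia Dh comp_assoc[OF sh f(1) h] f(2) xs in simp_all)
  moreover have "f \<cdot> s' = j \<cdot> b"
    by (rule mono_cancel[OF hm, of _ "Dom C s'"])
      (use comp_in_hom[OF sh' f(1)] jb Dh comp_assoc[OF sh' f(1) h] f(2) xs' in simp_all)
  ultimately show ?thesis using f(1) a b by blast
qed

lemma complementary_top_bottom:
  assumes Z: "initial C Z" and z: "z \<in> hom Z X"
  shows "complementary X (Id C X) z"
proof -
  note X = homD(5)[OF z]
  have "disjoint (Id C X) z"
    unfolding disjoint_def using strict_initial[OF Z] homD(2)[OF z] by simp
  moreover have "covers X (Id C X) z" by (simp add: covers_def)
  ultimately show ?thesis
    using Id_monos_into[OF X] initial_mono[OF Z z] by (simp add: complementary_def)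
qed

section \<open>Connectedness\<close>

text \<open>The top and bottom classes are always complemented, and they coincide exactly when
  \<open>X\<close> is initial. So there are two classes if and only if these two differ and exhaust
  \<open>Sub_c C X\<close>.\<close>

lemma card_Sub_c_eq_2_iff:
  assumes X: "X \<in> Ob C"
  shows "card (Sub_c C X) = 2 \<longleftrightarrow>
    \<not> initial C X \<and> (\<forall>s t. complementary X s t \<longrightarrow> initial C (Dom C s) \<or> Id C X \<preceq> s)"
proof -
  obtain Z where Z: "initial C Z" using ex_initial by blast
  obtain z where z: "z \<in> hom Z X" using initial_arrow[OF Z X] by blast
  note zm = initial_mono[OF Z z] and Im = Id_monos_into[OF X] and top = complementary_top_bottom[OF Z z]
  have le_I: "m \<preceq> Id C X" if m: "m \<in> monos_into C X" for m
    using factors_homI[OF monos_into_hom[OF m] _ comp_id_left[OF monos_into_hom[OF m]]]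
      monos_into_hom[OF m] X by simp
  have z_le: "z \<preceq> m" if m: "m \<in> monos_into C X" for m
    using initial_factors[OF Z z monos_into_hom[OF m]] .
  have le_z: "m \<preceq> z \<longleftrightarrow> initial C (Dom C m)" if m: "m \<in> monos_into C X" for m
    using factorsE[OF _ monos_into_hom[OF m], of z] strict_initial[OF Z] homD(2)[OF z]
      initial_factors[OF _ monos_into_hom[OF m] z] by metis
  have eq_I: "sub_class X m = sub_class X (Id C X) \<longleftrightarrow> Id C X \<preceq> m" if "m \<in> monos_into C X" for m
    using sub_class_eq_iff[OF that Im] le_I[OF that] by simp
  have eq_z: "sub_class X m = sub_class X z \<longleftrightarrow> initial C (Dom C m)" if "m \<in> monos_into C X" for m
    using sub_class_eq_iff[OF that zm] z_le[OF that] le_z[OF that] by simp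
  have sub: "{sub_class X (Id C X), sub_class X z} \<subseteq> Sub_c C X"
    using Sub_c_iff[OF Im] Sub_c_iff[OF zm] top complementary_sym[OF top] by blast
  have ne: "sub_class X (Id C X) \<noteq> sub_class X z \<longleftrightarrow> \<not> initial C X"
    using eq_z[OF Im] X by simp
  have ext: "\<exists>m t. S = sub_class X m \<and> m \<in> monos_into C X \<and> complementary X m t" if "S \<in> Sub_c C X" for S
  proof -
    have "S \<in> carrier (Sub C X)" using that by (simp add: Sub_c_def)
    then obtain m where m: "m \<in> monos_into C X" "S = sub_class X m" using carrier_SubE by blast
    then show ?thesis using Sub_c_iff[OF m(1)] that by blast
  qed
  show ?thesis
  proof
    assume c2: "card (Sub_c C X) = 2"
    have ni: "\<not> initial C X"
    proof
      assume i: "initial C X"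
      have "Sub_c C X \<subseteq> {sub_class X (Id C X)}"
      proof
        fix S assume "S \<in> Sub_c C X"
        then obtain m where m: "S = sub_class X m" "m \<in> monos_into C X" using ext by blast
        then show "S \<in> {sub_class X (Id C X)}"
          using eq_I[OF m(2)] initial_factors[OF i id_in_hom[OF X] monos_into_hom[OF m(2)]] by simp
      qed
      then have "card (Sub_c C X) \<le> 1" using card_mono[of "{sub_class X (Id C X)}"] by simp
      then show False using c2 by simp
    qed
    \<comment> \<open>Infinite sets have \<open>card\<close> equal to \<open>0\<close>, so the value
      \<open>2\<close> forces finiteness.\<close>
    have "finite (Sub_c C X)" using c2 card.infinite by fastforce
    then have eq: "{sub_class X (Id C X), sub_class X z} = Sub_c C X"
      using card_subset_eq[OF _ sub] c2 ne ni by simp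
    have "initial C (Dom C s) \<or> Id C X \<preceq> s" if st: "complementary X s t" for s t
    proof -
      have s: "s \<in> monos_into C X" using st by (simp add: complementary_def)
      then have "sub_class X s \<in> {sub_class X (Id C X), sub_class X z}" unfolding eq
        using Sub_c_iff[OF s] st by blast
      then show ?thesis using eq_I[OF s] eq_z[OF s] by blast
    qed
    then show "\<not> initial C X \<and> (\<forall>s t. complementary X s t \<longrightarrow> initial C (Dom C s) \<or> Id C X \<preceq> s)"
      using ni by blast
  next
    assume R: "\<not> initial C X \<and> (\<forall>s t. complementary X s t \<longrightarrow> initial C (Dom C s) \<or> Id C X \<preceq> s)"
    have "Sub_c C X \<subseteq> {sub_class X (Id C X), sub_class X z}"
    proof
      fix S assume "S \<in> Sub_c C X"
      then obtain m t where m: "S = sub_class X m" "m \<in> monos_into C X" "complementary X m t"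
        using ext by blast
      then show "S \<in> {sub_class X (Id C X), sub_class X z}"
        using R eq_I[OF m(2)] eq_z[OF m(2)] by blast
    qed
    then have "Sub_c C X = {sub_class X (Id C X), sub_class X z}" using sub by blast
    then show "card (Sub_c C X) = 2" using ne R by simp
  qed
qed

section \<open>The two implications between \<Pi>X = 1 and connectedness\<close>

lemma NS_not_initial_terminal:
  assumes "NS C" "terminal C I"
  shows "\<not> initial C I"
proof -
  have I: "I \<in> Ob C" using assms(2) by (simp add: terminal_def)
  \<comment> \<open>The identity of \<open>I\<close> is a global element, so the exclusiveness of
    the alternative in \<open>NS\<close> applies.\<close>
  then have "has_global_element C I" using assms(2) id_in_hom by (auto simp: has_global_element_def)
  then show ?thesis using assms(1) I unfolding NS_def by blast
qed

lemma terminal_quotient_if_connected: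
  assumes NS: "NS C" and ep: "epic C p" and p: "p \<in> hom X Q" and dec: "decidable C Q"
    and c2: "card (Sub_c C X) = 2"
  shows "terminal C Q"
proof -
  note X = homD(4)[OF p] and Q = homD(5)[OF p]
  have ni: "\<not> initial C X" and con: "\<And>s t. complementary X s t \<Longrightarrow> initial C (Dom C s) \<or> Id C X \<preceq> s"
    using c2 card_Sub_c_eq_2_iff[OF X] by blast+
  have "\<not> initial C Q" using strict_initial[OF _ p] ni by blast
  then have "has_global_element C Q" using NS Q unfolding NS_def by blast
  then obtain I x where I: "terminal C I" and x: "x \<in> hom I Q"
    unfolding has_global_element_def by blast
  obtain P d \<pi>1 \<pi>2 where d: "d \<in> hom Q P" and dc: "sub_class P d \<in> Sub_c C P"
    and P: "is_product C Q Q P \<pi>1 \<pi>2" and d1: "\<pi>1 \<cdot> d = Id C Q" and d2: "\<pi>2 \<cdot> d = Id C Q"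
    using dec unfolding decidable_def is_diagonal_def by blast
  have \<pi>: "\<pi>1 \<in> hom P Q" "\<pi>2 \<in> hom P Q"
    using P by (simp_all add: is_product_def)
  have dm: "d \<in> monos_into C P" using split_monos_into[OF d \<pi>(1) d1] .
  obtain t where dt: "complementary P d t" using dc Sub_c_iff[OF dm] by blast
  then have tm: "t \<in> monos_into C P" and dis: "disjoint d t"
    by (simp_all add: complementary_def)
  obtain k where k: "k \<in> hom Q I" using terminal_arrow[OF I Q] by blast
  note xk = comp_in_hom[OF k x]
  \<comment> \<open>\<open>g\<close> pairs the identity with the constant arrow at \<open>x\<close>.
    Hence \<open>s'\<close> below is the part of \<open>X\<close> where \<open>p\<close> equals
    \<open>x\<close>, and \<open>t'\<close> is its complement.\<close>
  obtain g where g: "g \<in> hom Q P" "\<pi>1 \<cdot> g = Id C Q" "\<pi>2 \<cdot> g = x \<cdot> k"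
    using productE[OF P id_in_hom[OF Q] xk] by blast
  note f = comp_in_hom[OF p g(1)]
  obtain s' a where s': "is_pullback C (g \<cdot> p) d s' a" using ex_pullback[OF f d] by blast
  obtain t' b where t': "is_pullback C (g \<cdot> p) t t' b"
    using ex_pullback[OF f monos_into_hom[OF tm]] by blast
  have ct: "complementary X s' t'" using complementary_pullback[OF dt f s' t'] .
  note s'_iff = pullback_mono(2)[OF s' f dm] and t'_iff = pullback_mono(2)[OF t' f tm]
  from con[OF ct] show ?thesis
  proof
    assume i: "initial C (Dom C s')"
    have sm: "s' \<in> monos_into C X" and tm': "t' \<in> monos_into C X" and cov: "covers X s' t'"
      using ct by (auto simp: complementary_def)
    have "s' \<preceq> t'"
      using initial_factors[OF i monos_into_hom[OF sm] monos_into_hom[OF tm']] .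
    then have "Id C X \<preceq> t'"
      using cov tm' factors_refl[OF monos_into_hom[OF tm']] by (simp add: covers_def)
    then have gp: "g \<cdot> p \<preceq> t"
      using t'_iff[OF id_in_hom[OF X]] comp_id_right[OF f] by simp
    \<comment> \<open>\<open>t''\<close> is the complement of the point \<open>x\<close> in
      \<open>Q\<close>. Since the epic \<open>p\<close> factors through it, \<open>t''\<close> is
      epic, hence everything by balancedness.\<close>
    obtain t'' c where pb: "is_pullback C g t t'' c"
      using ex_pullback[OF g(1) monos_into_hom[OF tm]] by blast
    note tm'' = pullback_mono[OF pb g(1) tm] and th'' = monos_into_hom[OF pullback_mono(1)[OF pb g(1) tm]]
    have "p \<preceq> t''" using tm''(2)[OF p] gp by simp
    then obtain l where l: "l \<in> hom X (Dom C t'')" "t'' \<cdot> l = p"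
      using factorsE[OF _ p] by blast
    have "epic C t''"
      unfolding epic_def homD(3)[OF th'']
    proof (intro conjI ballI impI)
      show "t'' \<in> Mor C" using homD(1)[OF th''] .
      fix T u v assume u: "u \<in> hom Q T" and v: "v \<in> hom Q T" and eq: "u \<cdot> t'' = v \<cdot> t''"
      have "u \<cdot> p = v \<cdot> p"
        using eq l comp_assoc[OF l(1) th'' u] comp_assoc[OF l(1) th'' v] by simp
      then show "u = v" using ep u v homD(3)[OF p] homD(5)[OF u] unfolding epic_def by blast
    qed
    then have "Id C Q \<preceq> t''" using epic_mono_top[OF tm''(1)] by simp
    then have gt: "g \<preceq> t" using tm''(2)[OF id_in_hom[OF Q]] comp_id_right[OF g(1)] by simp
    then obtain c where c: "c \<in> hom Q (Dom C t)" "t \<cdot> c = g"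
      using factorsE[OF _ g(1)] by blast
    \<comment> \<open>Now \<open>x\<close> itself lies in the complement of \<open>x\<close>:
      \<open>g \<cdot> x = d \<cdot> x\<close> is a common element of the diagonal and
      \<open>t\<close>, so \<open>I\<close> would be initial.\<close>
    have "k \<cdot> x = Id C I"
      using terminal_unique[OF I comp_in_hom[OF x k] id_in_hom[OF homD(4)[OF x]]] .
    then have "(x \<cdot> k) \<cdot> x = x" using comp_assoc[OF x k x] comp_id_right[OF x] by simp
    then have "g \<cdot> x = d \<cdot> x"
      by (intro product_eqI[OF P comp_in_hom[OF x g(1)] comp_in_hom[OF x d]])
        (use g d1 d2 comp_assoc[OF x g(1)] comp_assoc[OF x d] \<pi> comp_id_left[OF x] in simp_all)
    then have "d \<cdot> x = t \<cdot> (c \<cdot> x)"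
      using c comp_assoc[OF x c(1) monos_into_hom[OF tm]] by simp
    moreover have "x \<in> hom I (Dom C d)" using x homD(2)[OF d] by simp
    ultimately have "initial C I" using disjointD[OF dis _ comp_in_hom[OF x c(1)]] by blast
    then show ?thesis using NS_not_initial_terminal[OF NS I] by blast
  next
    assume "Id C X \<preceq> s'"
    then have "g \<cdot> p \<preceq> d" using s'_iff[OF id_in_hom[OF X]] comp_id_right[OF f] by simp
    then obtain c where c: "c \<in> hom X Q" "d \<cdot> c = g \<cdot> p"
      using factorsE[OF _ f] homD(2)[OF d] by metis
    \<comment> \<open>The two projections of \<open>d \<cdot> c = g \<cdot> p\<close> give
      \<open>p = c\<close> and \<open>(x \<cdot> k) \<cdot> p = c\<close>; cancelling
      \<open>p\<close> makes \<open>x\<close> inverse to \<open>k\<close>.\<close>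
    have "p = c"
      using c(2) comp_assoc[OF c(1) d \<pi>(1)] comp_assoc[OF p g(1) \<pi>(1)] d1 g(2)
        comp_id_left[OF c(1)] comp_id_left[OF p] by simp
    moreover have "(x \<cdot> k) \<cdot> p = c"
      using c(2) comp_assoc[OF c(1) d \<pi>(2)] comp_assoc[OF p g(1) \<pi>(2)] d2 g(3) comp_id_left[OF c(1)]
        by simp
    ultimately have "(x \<cdot> k) \<cdot> p = Id C Q \<cdot> p" using comp_id_left[OF p] by simp
    then have xk1: "x \<cdot> k = Id C Q"
      using ep xk id_in_hom[OF Q] homD(3)[OF p] Q unfolding epic_def by blast
    have "\<exists>!f. f \<in> hom Y Q" if Y: "Y \<in> Ob C" for Y
    proof -
      obtain e where e: "e \<in> hom Y I" using terminal_arrow[OF I Y] by blast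
      have "f = x \<cdot> e" if f: "f \<in> hom Y Q" for f
        using comp_assoc[OF f k x] xk1 comp_id_left[OF f] terminal_unique[OF I comp_in_hom[OF f k] e]
          by simp
      then show ?thesis using comp_in_hom[OF e x] by blast
    qed
    then show ?thesis using Q by (simp add: terminal_def)
  qed
qed

text \<open>By (NS) the part of \<open>Q\<close> that \<open>g\<close> sends into \<open>i\<close>
  is initial or has a global element. In the first case the cover by \<open>i\<close> and
  \<open>j\<close> forces \<open>g\<close> into \<open>j\<close>; in the second the element puts
  \<open>g\<close> into \<open>i\<close>.\<close>

lemma arrow_terminal_to_two:
  assumes NS: "NS C" and I: "terminal C I" and B: "is_coproduct C I I B i j"
    and Q: "terminal C Q" and g: "g \<in> hom Q B"
  shows "\<exists>e\<in>hom Q I. g = i \<cdot> e \<or> g = j \<cdot> e"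
proof -
  note QO = homD(4)[OF g]
  have i: "i \<in> hom I B" and j: "j \<in> hom I B" using B by (simp_all add: is_coproduct_def)
  obtain e where e: "e \<in> hom Q I" using terminal_arrow[OF I QO] by blast
  note je = comp_in_hom[OF e j]
  obtain m q where pb: "is_pullback C g i m q" using ex_pullback[OF g i] by blast
  note mD = pullbackD[OF pb g i]
  have "initial C (Dom C m) \<or> has_global_element C (Dom C m)"
    using NS homD(4)[OF mD(1)] unfolding NS_def by blast
  then show ?thesis
  proof
    assume A: "initial C (Dom C m)"
    obtain w where w: "is_equalizer C g (j \<cdot> e) w" using ex_equalizer[OF g je] by blast
    note wm = equalizer_monos_into[OF w g je]
    have "Id C Q \<preceq> w"
    proof (rule covers_pullback[OF coproduct_covers[OF B] terminal_mono[OF I i] terminal_mono[OF I j] g wm(1)])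
      fix Z a b assume a: "a \<in> hom Z Q" and b: "b \<in> hom Z (Dom C i)" and ab: "g \<cdot> a = i \<cdot> b"
      have b': "b \<in> hom Z I" using b homD(2)[OF i] by simp
      obtain l where "l \<in> hom Z (Dom C m)" using pullback_ex1[OF pb g i a b' ab] by blast
      then have "initial C Z" using strict_initial[OF A] by blast
      then show "a \<preceq> w" using initial_factors[OF _ a monos_into_hom[OF wm(1)]] by simp
    next
      fix Z a b assume a: "a \<in> hom Z Q" and b: "b \<in> hom Z (Dom C j)" and ab: "g \<cdot> a = j \<cdot> b"
      have "b = e \<cdot> a"
        using terminal_unique[OF I _ comp_in_hom[OF a e]] b homD(2)[OF j] by simp
      then show "a \<preceq> w" using wm(2)[OF a] ab comp_assoc[OF a e j] by simp
    qed
    then have "g \<cdot> Id C Q = (j \<cdot> e) \<cdot> Id C Q"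
      using wm(2)[OF id_in_hom[OF QO]] by simp
    then show ?thesis using comp_id_right[OF g] comp_id_right[OF je] e by auto
  next
    assume "has_global_element C (Dom C m)"
    then obtain J y where J: "terminal C J" and y: "y \<in> hom J (Dom C m)"
      unfolding has_global_element_def by blast
    obtain l where l: "l \<in> hom Q J" using terminal_arrow[OF J QO] by blast
    note yl = comp_in_hom[OF l y]
    note qy = comp_in_hom[OF yl mD(2)]
    \<comment> \<open>This endomorphism of the terminal \<open>Q\<close> must be the identity, so
      \<open>m\<close> has a section and the pullback square factors \<open>g\<close> through
      \<open>i\<close>.\<close>
    have "m \<cdot> (y \<cdot> l) = Id C Q"
      using terminal_unique[OF Q comp_in_hom[OF yl mD(1)] id_in_hom[OF QO]] .
    then have "g = i \<cdot> (q \<cdot> (y \<cdot> l))"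
      using comp_assoc[OF yl mD(1) g] comp_assoc[OF yl mD(2) i] mD(3) comp_id_right[OF g] by simp
    then show ?thesis using qy by blast
  qed
qed

lemma connected_if_terminal_quotient:
  assumes NS: "NS C" and dq: "decidable_quotient C X p" and Q: "terminal C (Cod C p)"
  shows "card (Sub_c C X) = 2"
proof -
  have ep: "epic C p" and p: "p \<in> hom X (Cod C p)"
    using dq by (auto simp: decidable_quotient_def epic_def in_hom_iff)
  note X = homD(4)[OF p] and QO = homD(5)[OF p]
  \<comment> \<open>For initial \<open>X\<close> the arrow \<open>p\<close> would be monic as well
    as epic, so balancedness would give an arrow from the terminal object to \<open>X\<close>,
    making the former initial.\<close>
  have "\<not> initial C X"
  proof
    assume i: "initial C X"
    obtain l where l: "l \<in> hom (Cod C p) X"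
      using epic_mono_top[OF initial_mono[OF i p] ep] factorsE[OF _ id_in_hom[OF QO], of p] homD(2)[OF p]
      by metis
    show False using strict_initial[OF i l] NS_not_initial_terminal[OF NS Q] by blast
  qed
  moreover have "initial C (Dom C s) \<or> Id C X \<preceq> s" if c: "complementary X s t" for s t
  proof -
    have sm: "s \<in> monos_into C X" and tm: "t \<in> monos_into C X" and cov: "covers X s t"
      using c by (auto simp: complementary_def)
    note sh = monos_into_hom[OF sm] and th = monos_into_hom[OF tm]
    obtain I where I: "terminal C I" using ex_terminal by blast
    then have IO: "I \<in> Ob C" by (simp add: terminal_def)
    obtain B i j where B: "is_coproduct C I I B i j" using ex_coproduct[OF IO IO] by blast
    then have two: "is_two C B" using I unfolding is_two_def by blast
    have i: "i \<in> hom I B" and j: "j \<in> hom I B" using B by (simp_all add: is_coproduct_def)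
    \<comment> \<open>\<open>f\<close> sends \<open>s\<close> into \<open>i\<close> and
      \<open>t\<close> into \<open>j\<close>, but it factors through the terminal quotient and so is
      constant at one injection. The piece sent to the other injection is then initial, as
      \<open>i\<close> and \<open>j\<close> are disjoint.\<close>
    obtain f a b where f: "f \<in> hom X B" and a: "a \<in> hom (Dom C s) I" "f \<cdot> s = i \<cdot> a"
      and b: "b \<in> hom (Dom C t) I" "f \<cdot> t = j \<cdot> b"
      using complementary_arrow_to_two[OF c I B] by blast
    obtain g where g: "g \<in> hom (Cod C p) B" "g \<cdot> p = f"
      using dq two f unfolding decidable_quotient_def by blast
    obtain e where e: "e \<in> hom (Cod C p) I" "g = i \<cdot> e \<or> g = j \<cdot> e"
      using arrow_terminal_to_two[OF NS I B Q g(1)] by blast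
    note e' = comp_in_hom[OF p e(1)]
    note dis = two_disjoint[OF I B, unfolded disjoint_def homD(2)[OF i] homD(2)[OF j], rule_format]
    from e(2) show ?thesis
    proof
      assume "g = i \<cdot> e"
      then have "f = i \<cdot> (e \<cdot> p)" using g comp_assoc[OF p e(1) i] by simp
      then have "i \<cdot> ((e \<cdot> p) \<cdot> t) = j \<cdot> b"
        using b comp_assoc[OF th e' i] by simp
      then have "initial C (Dom C t)" using dis[OF comp_in_hom[OF th e'] b(1)] by simp
      then have "t \<preceq> s" using initial_factors[OF _ th sh] by simp
      then show ?thesis using cov sm factors_refl[OF sh] by (simp add: covers_def)
    next
      assume "g = j \<cdot> e"
      then have "f = j \<cdot> (e \<cdot> p)" using g comp_assoc[OF p e(1) j] by simp
      then have "i \<cdot> a = j \<cdot> ((e \<cdot> p) \<cdot> s)"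
        using a comp_assoc[OF sh e' j] by simp
      then have "initial C (Dom C s)" using dis[OF a(1) comp_in_hom[OF sh e']] by simp
      then show ?thesis by simp
    qed
  qed
  ultimately show ?thesis using card_Sub_c_eq_2_iff[OF X] by blast
qed

end

theorem proposition1p1:
  fixes C :: "('o, 'm) cat"
    and PiOb :: "'o \<Rightarrow> 'o"
    and p :: "'o \<Rightarrow> 'm"
    and X :: 'o
  assumes "elementary_topos C"
    and "NS C"
    and "DQO C"
    and "\<And>Y. Y \<in> Ob C \<Longrightarrow> decidable_quotient C Y (p Y) \<and> Cod C (p Y) = PiOb Y"
    and "X \<in> Ob C"
  shows "(terminal C (PiOb X) \<longleftrightarrow> card (Sub_c C X) = 2) \<and>
         (terminal C (PiOb X) \<longleftrightarrow> connected_object C X)"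
proof -
  interpret elementary_topos C by fact
  have dq: "decidable_quotient C X (p X)" and cod: "Cod C (p X) = PiOb X"
    using assms(4)[OF assms(5)] by simp_all
  then have "epic C (p X)" "p X \<in> hom_set C X (PiOb X)" "decidable C (PiOb X)"
    by (auto simp: decidable_quotient_def epic_def hom_set_def)
  then have "terminal C (PiOb X) \<longleftrightarrow> card (Sub_c C X) = 2"
    using terminal_quotient_if_connected[OF assms(2)] connected_if_terminal_quotient[OF assms(2) dq] cod
    by auto
  then show ?thesis using assms(5) by (simp add: connected_object_def)
qed

end
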